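(* Let $\mathrm{BO}_{48}$ be the binary octahedral group and let $G=\mathcal{C}(\mathrm{BO}_{48},\Gamma)$ be a commuting graph on $\mathrm{BO}_{48}$. Then, up to isomorphism, $$G=\begin{cases}K_2 & \text{when }\Gamma=\mathcal{B}_i\text{ for } i=1,\ldots,7,\\ K_4 & \text{when }\Gamma=\mathcal{C}_i\text{ for } i=1,\ldots,4,\\ K_6 & \text{when }\Gamma=\mathcal{D}_i\text{ for } i=1,\ldots,3,\\ K_2\vee(6K_2\cup 4K_4\cup 3K_6) & \text{when }\Gamma=\mathrm{BO}_{48}.\end{cases}$$
   Context: The binary octahedral group, of order 48, is presented as $\mathrm{BO}_{48}=\langle r,s,t\mid r^2=s^3=t^4=rst\rangle$. Consider the following subsets of $\mathrm{BO}_{48}$: $\mathcal{B}_1=Z(\mathrm{BO}_{48})=\{1,r^2\}$ (the center), $\mathcal{B}_2=\{r,r^{-1}\}$, $\mathcal{B}_3=\{ts,s^{-1}t^{-1}\}$, $\mathcal{B}_4=\{s^{-1}ts^{-1},st^{-1}s\}$, $\mathcal{B}_5=\{t^{-1}r^{-1}t,t^{-1}rt\}$, $\mathcal{B}_6=\{r^{-1}tsr,rtsr\}$, $\mathcal{B}_7=\{t^{-1}r^{-1}ts,t^{-1}rts\}$; $\mathcal{C}_1=\{s,s^{-1},s^{-2},tr\}$, $\mathcal{C}_2=\{rt,r^{-1}t,t^{-1}r^{-1},t^{-1}r\}$, $\mathcal{C}_3=\{rts,r^{-1}ts,tsr,s^{-1}t^{-1}r\}$, $\mathcal{C}_4=\{srt,t^2s,t^{-2}s,s^{-1}t^2\}$;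 $\mathcal{D}_1=\{t,t^2,t^{-1},t^{-2},rs,s^{-1}r^{-1}\}$, $\mathcal{D}_2=\{sr,t^{-1}s,st^{-1}r^{-1},st^{-1}r,s^{-1}t,r^{-1}s^{-1}\}$, $\mathcal{D}_3=\{t^2r,s^{-1}t^2s,srts,st^{-1},ts^{-1},srs\}$. For a group $H$ and a nonempty subset $\Gamma\subseteq H$, $\mathcal{C}(H,\Gamma)$ is the simple graph with node set $\Gamma$ in which two distinct elements are joined by an edge if and only if they commute in $H$. $K_m$ is the complete graph on $m$ nodes, $rK_m$ (for an integer $r$) is the graph consisting of $r$ (disjoint) copies of $K_m$, $\cup$ denotes disjoint union of graphs, and the join $G_1\vee G_2$ is the graph with node set $V(G_1)\cup V(G_2)$ and edge set $E(G_1)\cup E(G_2)\cup\{y\sim z: y\in V(G_1),z\in V(G_2)\}$. *)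

theory Defs
  imports "HOL-Algebra.Group" "Graph_Theory.Graph_Theory"
begin

section \<open>Groups given by generators and relations\<close>

text \<open>A letter \<open>(x, False)\<close> stands for the generator \<open>x\<close>, and \<open>(x, True)\<close> for its formal inverse.
  A relation \<open>u = v\<close> is a pair \<open>(u, v)\<close> of words. The group presented by a set of relations
  consists of the words modulo the least congruence that contains the relations and the
  cancellations of a letter with its inverse; every element of the type \<open>'g\<close> is a generator.\<close>

type_synonym 'g word = "('g \<times> bool) list"

inductive_set word_cong :: "('g word \<times> 'g word) set \<Rightarrow> ('g word \<times> 'g word) set"
  for Rel where
  refl: "(u, u) \<in> word_cong Rel"
| sym: "(u, v) \<in> word_cong Rel \<Longrightarrow> (v, u) \<in> word_cong Rel"
| trans: "(u, v) \<in> word_cong Rel \<Longrightarrow> (v, w) \<in> word_cong Rel \<Longrightarrow> (u, w) \<in> word_cong Rel"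
| append: "(u, u') \<in> word_cong Rel \<Longrightarrow> (v, v') \<in> word_cong Rel \<Longrightarrow> (u @ v, u' @ v') \<in> word_cong Rel"
| cancel: "([(x, b), (x, \<not> b)], []) \<in> word_cong Rel"
| rel: "(u, v) \<in> Rel \<Longrightarrow> (u, v) \<in> word_cong Rel"

definition word_class :: "('g word \<times> 'g word) set \<Rightarrow> 'g word \<Rightarrow> 'g word set" where
  "word_class Rel w = word_cong Rel `` {w}"

definition presented_group :: "('g word \<times> 'g word) set \<Rightarrow> 'g word set monoid" where
  "presented_group Rel =
    \<lparr> carrier = UNIV // word_cong Rel,
      monoid.mult = (\<lambda>A B. \<Union>u\<in>A. \<Union>v\<in>B. word_class Rel (u @ v)),
      one = word_class Rel [] \<rparr>"

definition generator :: "('g word \<times> 'g word) set \<Rightarrow> 'g \<Rightarrow> 'g word set" where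
  "generator Rel x = word_class Rel [(x, False)]"

lemma equiv_word_cong: "equiv UNIV (word_cong Rel)"
  by (rule equivI)
     (auto simp: refl_on_def sym_def trans_def intro: word_cong.refl word_cong.sym word_cong.trans)

lemma word_class_eq_iff: "word_class Rel u = word_class Rel v \<longleftrightarrow> (u, v) \<in> word_cong Rel"
  unfolding word_class_def using eq_equiv_class_iff[OF equiv_word_cong] by auto

lemma carrier_presented_group: "carrier (presented_group Rel) = range (word_class Rel)"
  by (auto simp: presented_group_def quotient_def word_class_def)

lemma one_presented_group: "\<one>\<^bsub>presented_group Rel\<^esub> = word_class Rel []"
  by (simp add: presented_group_def)

lemma mult_presented_group:
  "word_class Rel u \<otimes>\<^bsub>presented_group Rel\<^esub> word_class Rel v = word_class Rel (u @ v)"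
proof -
  have "word_class Rel (u' @ v') = word_class Rel (u @ v)"
    if "u' \<in> word_class Rel u" "v' \<in> word_class Rel v" for u' v'
    using that unfolding word_class_eq_iff
    by (auto simp: word_class_def intro: word_cong.append word_cong.sym)
  then have "(\<Union>u'\<in>word_class Rel u. \<Union>v'\<in>word_class Rel v. word_class Rel (u' @ v'))
      = (\<Union>u'\<in>word_class Rel u. \<Union>v'\<in>word_class Rel v. word_class Rel (u @ v))"
    by (intro SUP_cong) simp_all
  moreover have "u \<in> word_class Rel u" "v \<in> word_class Rel v"
    by (simp_all add: word_class_def word_cong.refl)
  then have "(\<Union>u'\<in>word_class Rel u. \<Union>v'\<in>word_class Rel v. word_class Rel (u @ v))
      = word_class Rel (u @ v)"
    by blast
  ultimately show ?thesis
    by (simp add: presented_group_def)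
qed

lemma word_cong_inverse:
  "(rev (map (\<lambda>(x, b). (x, \<not> b)) w) @ w, []) \<in> word_cong Rel"
proof (induction w)
  case Nil
  show ?case by (simp add: word_cong.refl)
next
  case (Cons a w)
  obtain x b where a: "a = (x, b)" by (cases a)
  let ?w' = "rev (map (\<lambda>(x, b). (x, \<not> b)) w)"
  have "([(x, \<not> b), (x, b)], []) \<in> word_cong Rel"
    using word_cong.cancel[of x "\<not> b" Rel] by simp
  then have "(([(x, \<not> b), (x, b)]) @ w, [] @ w) \<in> word_cong Rel"
    by (rule word_cong.append) (rule word_cong.refl)
  then have "(?w' @ ([(x, \<not> b), (x, b)] @ w), ?w' @ ([] @ w)) \<in> word_cong Rel"
    by (rule word_cong.append[OF word_cong.refl])
  then show ?case
    using Cons.IH by (auto simp: a intro: word_cong.trans)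
qed

lemma group_presented_group: "group (presented_group Rel)"
proof (rule groupI)
  fix A assume "A \<in> carrier (presented_group Rel)"
  then obtain w where w: "A = word_class Rel w"
    by (auto simp: carrier_presented_group)
  let ?Y = "word_class Rel (rev (map (\<lambda>(x, b). (x, \<not> b)) w))"
  have "?Y \<otimes>\<^bsub>presented_group Rel\<^esub> A = \<one>\<^bsub>presented_group Rel\<^esub>"
    by (simp add: w mult_presented_group one_presented_group word_class_eq_iff word_cong_inverse)
  then show "\<exists>Y\<in>carrier (presented_group Rel). Y \<otimes>\<^bsub>presented_group Rel\<^esub> A = \<one>\<^bsub>presented_group Rel\<^esub>"
    by (auto simp: carrier_presented_group)
qed (auto simp: carrier_presented_group one_presented_group mult_presented_group)

text \<open>The universal property: an assignment of elements of a group \<open>H\<close> to the generators that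
  respects the relations extends to a homomorphism; it is unique
  because every element is a product of generators and their inverses.\<close>

definition eval_word :: "('a, 'm) monoid_scheme \<Rightarrow> ('g \<Rightarrow> 'a) \<Rightarrow> 'g word \<Rightarrow> 'a" where
  "eval_word H f w =
    foldr (\<lambda>(x, b) a. (if b then inv\<^bsub>H\<^esub> f x else f x) \<otimes>\<^bsub>H\<^esub> a) w \<one>\<^bsub>H\<^esub>"

lemma eval_word_simps:
  "eval_word H f [] = \<one>\<^bsub>H\<^esub>"
  "eval_word H f ((x, b) # w) = (if b then inv\<^bsub>H\<^esub> f x else f x) \<otimes>\<^bsub>H\<^esub> eval_word H f w"
  by (simp_all add: eval_word_def)

lemma eval_word_closed:
  assumes "group H" "\<And>x. f x \<in> carrier H"
  shows "eval_word H f w \<in> carrier H"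
proof -
  interpret group H by fact
  show ?thesis by (induction w) (auto simp: eval_word_simps assms(2))
qed

lemma eval_word_append:
  assumes "group H" "\<And>x. f x \<in> carrier H"
  shows "eval_word H f (u @ v) = eval_word H f u \<otimes>\<^bsub>H\<^esub> eval_word H f v"
proof -
  interpret group H by fact
  note [simp] = eval_word_simps eval_word_closed[OF assms] assms(2)
  show ?thesis
  proof (induction u)
    case (Cons a u)
    then show ?case by (cases a) (simp add: m_assoc)
  qed simp
qed

lemma eval_word_cong:
  assumes "group H" "\<And>x. f x \<in> carrier H"
    and rel: "\<And>u v. (u, v) \<in> Rel \<Longrightarrow> eval_word H f u = eval_word H f v"
    and "(u, v) \<in> word_cong Rel"
  shows "eval_word H f u = eval_word H f v"
proof -
  interpret group H by fact
  show ?thesis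
    using assms(4)
    by induction (auto simp: eval_word_append[OF assms(1,2)] eval_word_simps assms(2) rel)
qed

lemma presented_group_universal:
  assumes "group H" "\<And>x. f x \<in> carrier H"
    and rel: "\<And>u v. (u, v) \<in> Rel \<Longrightarrow> eval_word H f u = eval_word H f v"
  obtains h where "h \<in> hom (presented_group Rel) H" "\<And>w. h (word_class Rel w) = eval_word H f w"
    "\<And>x. h (generator Rel x) = f x"
proof -
  interpret group H by fact
  define h where "h A = eval_word H f (SOME w. A = word_class Rel w)" for A
  have h: "h (word_class Rel w) = eval_word H f w" for w
  proof -
    have "word_class Rel w = word_class Rel (SOME w'. word_class Rel w = word_class Rel w')"
      by (rule someI[of _ w]) simp
    then have "(w, SOME w'. word_class Rel w = word_class Rel w') \<in> word_cong Rel"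
      by (simp only: word_class_eq_iff)
    then have "eval_word H f w = eval_word H f (SOME w'. word_class Rel w = word_class Rel w')"
      by (rule eval_word_cong[OF assms(1,2) rel, rotated])
    then show ?thesis
      by (simp add: h_def)
  qed
  moreover have "h \<in> hom (presented_group Rel) H"
    by (auto simp: hom_def carrier_presented_group mult_presented_group h
        eval_word_closed[OF assms(1,2)] eval_word_append[OF assms(1,2)])
  moreover have "h (generator Rel x) = f x" for x
    by (simp add: generator_def h eval_word_simps assms(2))
  ultimately show ?thesis using that by blast
qed

lemma word_class_eq_eval_word:
  "word_class Rel w = eval_word (presented_group Rel) (generator Rel) w"
proof -
  interpret group "presented_group Rel" by (rule group_presented_group)
  have gen: "generator Rel x \<in> carrier (presented_group Rel)" for x
    by (simp add: generator_def carrier_presented_group)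
  have inv_gen: "inv\<^bsub>presented_group Rel\<^esub> generator Rel x = word_class Rel [(x, True)]" for x
  proof (rule inv_equality)
    show "word_class Rel [(x, True)] \<otimes>\<^bsub>presented_group Rel\<^esub> generator Rel x
        = \<one>\<^bsub>presented_group Rel\<^esub>"
      using word_cong.cancel[of x True Rel]
      by (simp add: generator_def mult_presented_group one_presented_group word_class_eq_iff)
  qed (simp_all add: gen, simp add: carrier_presented_group)
  show ?thesis
  proof (induction w)
    case Nil
    show ?case by (simp add: eval_word_simps one_presented_group)
  next
    case (Cons a w)
    obtain x b where a: "a = (x, b)" by (cases a)
    have "word_class Rel (a # w) = word_class Rel [(x, b)] \<otimes>\<^bsub>presented_group Rel\<^esub> word_class Rel w"
      by (simp add: a mult_presented_group)
    then show ?case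
      by (simp add: a eval_word_simps Cons.IH[symmetric] inv_gen) (simp add: generator_def)
  qed
qed


section \<open>The binary octahedral group\<close>

datatype bo_gen = gen_r | gen_s | gen_t

text \<open>The relations \<open>r\<^sup>2 = s\<^sup>3 = t\<^sup>4 = rst\<close>.\<close>

definition BO_rels :: "(bo_gen word \<times> bo_gen word) set" where
  "BO_rels =
    {(replicate 2 (gen_r, False), replicate 3 (gen_s, False)),
     (replicate 3 (gen_s, False), replicate 4 (gen_t, False)),
     (replicate 4 (gen_t, False), [(gen_r, False), (gen_s, False), (gen_t, False)])}"

definition BO48 :: "bo_gen word set monoid" where
  "BO48 = presented_group BO_rels"

definition bo_r :: "bo_gen word set" where "bo_r = generator BO_rels gen_r"
definition bo_s :: "bo_gen word set" where "bo_s = generator BO_rels gen_s"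
definition bo_t :: "bo_gen word set" where "bo_t = generator BO_rels gen_t"

lemma group_BO48: "group BO48"
  unfolding BO48_def by (rule group_presented_group)

lemma BO48_relations:
  "bo_r [^]\<^bsub>BO48\<^esub> (2::nat) = bo_s [^]\<^bsub>BO48\<^esub> (3::nat)"
  "bo_s [^]\<^bsub>BO48\<^esub> (3::nat) = bo_t [^]\<^bsub>BO48\<^esub> (4::nat)"
  "bo_t [^]\<^bsub>BO48\<^esub> (4::nat) = bo_r \<otimes>\<^bsub>BO48\<^esub> bo_s \<otimes>\<^bsub>BO48\<^esub> bo_t"
proof -
  interpret group BO48 by (rule group_BO48)
  have pow: "word_class BO_rels [(x, False)] [^]\<^bsub>BO48\<^esub> n = word_class BO_rels (replicate n (x, False))"
    for x and n :: nat
  proof (induction n)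
    case 0
    show ?case by (simp add: BO48_def one_presented_group)
  next
    case (Suc n)
    then show ?case
      by (simp add: BO48_def mult_presented_group replicate_append_same)
  qed
  have rels: "word_class BO_rels u = word_class BO_rels v" if "(u, v) \<in> BO_rels" for u v
    using that by (simp add: word_class_eq_iff word_cong.rel)
  have prod: "bo_r \<otimes>\<^bsub>BO48\<^esub> bo_s \<otimes>\<^bsub>BO48\<^esub> bo_t
      = word_class BO_rels [(gen_r, False), (gen_s, False), (gen_t, False)]"
    by (simp add: bo_r_def bo_s_def bo_t_def generator_def BO48_def mult_presented_group)
  show "bo_r [^]\<^bsub>BO48\<^esub> (2::nat) = bo_s [^]\<^bsub>BO48\<^esub> (3::nat)"
    "bo_s [^]\<^bsub>BO48\<^esub> (3::nat) = bo_t [^]\<^bsub>BO48\<^esub> (4::nat)"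
    "bo_t [^]\<^bsub>BO48\<^esub> (4::nat) = bo_r \<otimes>\<^bsub>BO48\<^esub> bo_s \<otimes>\<^bsub>BO48\<^esub> bo_t"
    unfolding prod unfolding bo_r_def bo_s_def bo_t_def generator_def pow
    by (rule rels, simp add: BO_rels_def)+
qed

abbreviation bo_mult :: "bo_gen word set \<Rightarrow> bo_gen word set \<Rightarrow> bo_gen word set"
    (infixl \<open>\<star>\<close> 70) where
  "x \<star> y \<equiv> x \<otimes>\<^bsub>BO48\<^esub> y"

abbreviation bo_inv :: "bo_gen word set \<Rightarrow> bo_gen word set" (\<open>_\<^sup>-\<^sup>1\<close> [1000] 999) where
  "x\<^sup>-\<^sup>1 \<equiv> inv\<^bsub>BO48\<^esub> x"

abbreviation bo_pow :: "bo_gen word set \<Rightarrow> int \<Rightarrow> bo_gen word set" (infixr \<open>\<up>\<close> 75) where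
  "x \<up> k \<equiv> x [^]\<^bsub>BO48\<^esub> k"

context
begin

private abbreviation (input) r where "r \<equiv> bo_r"
private abbreviation (input) s where "s \<equiv> bo_s"
private abbreviation (input) t where "t \<equiv> bo_t"

definition BO_B1 :: "bo_gen word set set" where
  "BO_B1 = {\<one>\<^bsub>BO48\<^esub>, r \<up> 2}"

definition BO_B2 :: "bo_gen word set set" where
  "BO_B2 = {r, r\<^sup>-\<^sup>1}"

definition BO_B3 :: "bo_gen word set set" where
  "BO_B3 = {t \<star> s, s\<^sup>-\<^sup>1 \<star> t\<^sup>-\<^sup>1}"

definition BO_B4 :: "bo_gen word set set" where
  "BO_B4 = {s\<^sup>-\<^sup>1 \<star> t \<star> s\<^sup>-\<^sup>1, s \<star> t\<^sup>-\<^sup>1 \<star> s}"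

definition BO_B5 :: "bo_gen word set set" where
  "BO_B5 = {t\<^sup>-\<^sup>1 \<star> r\<^sup>-\<^sup>1 \<star> t, t\<^sup>-\<^sup>1 \<star> r \<star> t}"

definition BO_B6 :: "bo_gen word set set" where
  "BO_B6 = {r\<^sup>-\<^sup>1 \<star> t \<star> s \<star> r, r \<star> t \<star> s \<star> r}"

definition BO_B7 :: "bo_gen word set set" where
  "BO_B7 = {t\<^sup>-\<^sup>1 \<star> r\<^sup>-\<^sup>1 \<star> t \<star> s, t\<^sup>-\<^sup>1 \<star> r \<star> t \<star> s}"

definition BO_C1 :: "bo_gen word set set" where
  "BO_C1 = {s, s\<^sup>-\<^sup>1, s \<up> (- 2), t \<star> r}"

definition BO_C2 :: "bo_gen word set set" where
  "BO_C2 = {r \<star> t, r\<^sup>-\<^sup>1 \<star> t, t\<^sup>-\<^sup>1 \<star> r\<^sup>-\<^sup>1, t\<^sup>-\<^sup>1 \<star> r}"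

definition BO_C3 :: "bo_gen word set set" where
  "BO_C3 = {r \<star> t \<star> s, r\<^sup>-\<^sup>1 \<star> t \<star> s, t \<star> s \<star> r, s\<^sup>-\<^sup>1 \<star> t\<^sup>-\<^sup>1 \<star> r}"

definition BO_C4 :: "bo_gen word set set" where
  "BO_C4 = {s \<star> r \<star> t, t \<up> 2 \<star> s, t \<up> (- 2) \<star> s, s\<^sup>-\<^sup>1 \<star> t \<up> 2}"

definition BO_D1 :: "bo_gen word set set" where
  "BO_D1 = {t, t \<up> 2, t\<^sup>-\<^sup>1, t \<up> (- 2), r \<star> s, s\<^sup>-\<^sup>1 \<star> r\<^sup>-\<^sup>1}"

definition BO_D2 :: "bo_gen word set set" where
  "BO_D2 = {s \<star> r, t\<^sup>-\<^sup>1 \<star> s, s \<star> t\<^sup>-\<^sup>1 \<star> r\<^sup>-\<^sup>1, s \<star> t\<^sup>-\<^sup>1 \<star> r, s\<^sup>-\<^sup>1 \<star> t, r\<^sup>-\<^sup>1 \<star> s\<^sup>-\<^sup>1}"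

definition BO_D3 :: "bo_gen word set set" where
  "BO_D3 = {t \<up> 2 \<star> r, s\<^sup>-\<^sup>1 \<star> t \<up> 2 \<star> s, s \<star> r \<star> t \<star> s, s \<star> t\<^sup>-\<^sup>1, t \<star> s\<^sup>-\<^sup>1, s \<star> r \<star> s}"

end


section \<open>Graphs\<close>

text \<open>Simple graphs are symmetric loop-free digraphs without parallel arcs: an edge between \<open>x\<close>
  and \<open>y\<close> is the pair of arcs \<open>(x, y)\<close> and \<open>(y, x)\<close>.\<close>

definition commuting_graph :: "('a, 'm) monoid_scheme \<Rightarrow> 'a set \<Rightarrow> 'a pair_pre_digraph" where
  "commuting_graph H \<Gamma> =
    \<lparr> pverts = \<Gamma>,
      parcs = {(x, y). x \<in> \<Gamma> \<and> y \<in> \<Gamma> \<and> x \<noteq> y \<and> x \<otimes>\<^bsub>H\<^esub> y = y \<otimes>\<^bsub>H\<^esub> x} \<rparr>"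

definition complete_graph :: "nat \<Rightarrow> nat pair_pre_digraph" where
  "complete_graph m =
    \<lparr> pverts = {..<m}, parcs = {(i, j). i < m \<and> j < m \<and> i \<noteq> j} \<rparr>"

definition graph_copies :: "nat \<Rightarrow> 'a pair_pre_digraph \<Rightarrow> (nat \<times> 'a) pair_pre_digraph" where
  "graph_copies k G =
    \<lparr> pverts = {..<k} \<times> pverts G,
      parcs = {((i, x), (j, y)). i < k \<and> i = j \<and> (x, y) \<in> parcs G} \<rparr>"

definition disjoint_union ::
    "'a pair_pre_digraph \<Rightarrow> 'b pair_pre_digraph \<Rightarrow> ('a + 'b) pair_pre_digraph" where
  "disjoint_union G H =
    \<lparr> pverts = pverts G <+> pverts H,
      parcs = {(Inl x, Inl y) | x y. (x, y) \<in> parcs G} \<union> {(Inr x, Inr y) | x y. (x, y) \<in> parcs H} \<rparr>"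

definition graph_join ::
    "'a pair_pre_digraph \<Rightarrow> 'b pair_pre_digraph \<Rightarrow> ('a + 'b) pair_pre_digraph" where
  "graph_join G H =
    \<lparr> pverts = pverts G <+> pverts H,
      parcs = parcs (disjoint_union G H) \<union>
        {(Inl y, Inr z) | y z. y \<in> pverts G \<and> z \<in> pverts H} \<union>
        {(Inr z, Inl y) | y z. y \<in> pverts G \<and> z \<in> pverts H} \<rparr>"

abbreviation graph_iso :: "'a pair_pre_digraph \<Rightarrow> 'b pair_pre_digraph \<Rightarrow> bool" (infix \<open>\<simeq>\<^sub>g\<close> 50) where
  "G \<simeq>\<^sub>g H \<equiv> digraph_iso (with_proj G) (with_proj H)"

lemma pair_bidirected_commuting_graph: "pair_bidirected_digraph (commuting_graph H \<Gamma>)"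
  by unfold_locales (auto simp: commuting_graph_def symmetric_def sym_def)

lemma complete_digraph_complete_graph: "complete_digraph m (with_proj (complete_graph m))"
proof -
  have "parcs (complete_graph m) \<subseteq> {..<m} \<times> {..<m}"
    by (auto simp: complete_graph_def)
  then have "finite (parcs (complete_graph m))"
    by (rule finite_subset) simp
  then show ?thesis
    unfolding complete_digraph_pair_def by (auto simp: complete_graph_def)
qed

end

theory Submission
  imports Defs "HOL-Algebra.Generated_Groups"
begin

text \<open>The relations amount to \<open>r = st\<close>, \<open>tst = s\<^sup>2\<close>, \<open>sts = t\<^sup>3\<close>, \<open>s\<^sup>3 = t\<^sup>4 = z\<close>. The conjugates of \<open>t\<^sup>2\<close>
  under \<open>s\<close> multiply like quaternion units, which forces \<open>z\<^sup>2 = 1\<close>; coset enumeration over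
  \<open>\<langle>t\<rangle>\<close> then bounds the order of the group by \<open>8 \<cdot> 6 = 48\<close>. A homomorphism to \<open>SL\<^sub>2\<close> over the field
  with seven elements takes 48 distinct values on the words listed in the fourteen sets, so it is
  injective and these sets partition the group. Equality and commutation become statements about
  explicit matrices: the sets other than the centre are the blocks of commuting elements, and no two
  elements of different blocks commute.\<close>

section \<open>Isomorphisms of commuting graphs\<close>

text \<open>A digraph isomorphism also carries an arc map and new head and tail functions. Arcs of a
  pair digraph are pairs, so \<open>f\<close> determines the arc map \<open>map_prod f f\<close>,
  and the two projections are kept.\<close>

lemma with_proj_isoI:
  fixes G :: "'a pair_pre_digraph" and H :: "'b pair_pre_digraph"
  assumes G: "parcs G \<subseteq> pverts G \<times> pverts G" and H: "parcs H \<subseteq> pverts H \<times> pverts H"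
    and f: "bij_betw f (pverts G) (pverts H)"
    and arcs: "\<And>x y. x \<in> pverts G \<Longrightarrow> y \<in> pverts G \<Longrightarrow> (x, y) \<in> parcs G \<longleftrightarrow> (f x, f y) \<in> parcs H"
  shows "G \<simeq>\<^sub>g H"
proof -
  let ?hom = "\<lparr> iso_verts = f, iso_arcs = map_prod f f, iso_head = snd, iso_tail = fst \<rparr>"
  have "wf_digraph (with_proj G)"
    using G by unfold_locales auto
  moreover have inj: "inj_on f (pverts G)"
    using f by (simp add: bij_betw_def)
  moreover have "inj_on (map_prod f f) (parcs G)"
    using map_prod_inj_on[OF inj inj] G by (rule inj_on_subset)
  ultimately have "pre_digraph.digraph_isomorphism (with_proj G) ?hom"
    by (simp add: pre_digraph.digraph_isomorphism_def)
  moreover have "map_prod f f ` parcs G = parcs H"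
  proof
    show "map_prod f f ` parcs G \<subseteq> parcs H"
      using G arcs by auto
    show "parcs H \<subseteq> map_prod f f ` parcs G"
    proof
      fix p assume p: "p \<in> parcs H"
      then obtain x y where "p = (f x, f y)" "x \<in> pverts G" "y \<in> pverts G"
        using H bij_betw_imp_surj_on[OF f] by (cases p) blast
      with p arcs show "p \<in> map_prod f f ` parcs G"
        by (auto intro!: image_eqI[of _ _ "(x, y)"])
    qed
  qed
  then have "with_proj H = app_iso ?hom (with_proj G)"
    using f by (simp add: app_iso_def with_proj_def bij_betw_def)
  ultimately show ?thesis
    unfolding digraph_iso_def by blast
qed

text \<open>Since the target is again a pair digraph, the new tail and head functions must be
  \<open>fst\<close> and \<open>snd\<close>. Compatibility with the vertex map then forces the arc
  map to be \<open>map_prod ?f ?f\<close> on the arcs.\<close>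

lemma with_proj_isoE:
  fixes G :: "'a pair_pre_digraph" and H :: "'b pair_pre_digraph"
  assumes "G \<simeq>\<^sub>g H"
  obtains f where "bij_betw f (pverts G) (pverts H)"
    "\<And>x y. x \<in> pverts G \<Longrightarrow> y \<in> pverts G \<Longrightarrow> (x, y) \<in> parcs G \<longleftrightarrow> (f x, f y) \<in> parcs H"
proof -
  obtain hom where hom: "pre_digraph.digraph_isomorphism (with_proj G) hom"
    and H: "with_proj H = app_iso hom (with_proj G)"
    using assms by (auto simp: digraph_iso_def)
  let ?f = "iso_verts hom"
  have V: "pverts H = ?f ` pverts G" and A: "parcs H = iso_arcs hom ` parcs G"
    and fst: "iso_tail hom = fst" and snd: "iso_head hom = snd"
    using arg_cong[OF H, of verts] arg_cong[OF H, of arcs] arg_cong[OF H, of tail]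
      arg_cong[OF H, of head] by auto
  have inj: "inj_on ?f (pverts G)" and wf: "wf_digraph (with_proj G)"
    using hom by (auto simp: pre_digraph.digraph_isomorphism_def)
  have eq: "iso_arcs hom a = map_prod ?f ?f a" if "a \<in> parcs G" for a
    using hom that fst snd by (cases a) (auto simp: pre_digraph.digraph_isomorphism_def prod_eq_iff)
  then have A': "parcs H = map_prod ?f ?f ` parcs G"
    unfolding A by (rule image_cong[OF HOL.refl])
  have sub: "x \<in> pverts G \<and> y \<in> pverts G" if "(x, y) \<in> parcs G" for x y
    using wf_digraph.tail_in_verts[OF wf, of "(x, y)"] wf_digraph.head_in_verts[OF wf, of "(x, y)"]
      that by simp
  show ?thesis
  proof (rule that)
    show "bij_betw ?f (pverts G) (pverts H)"
      using inj V by (simp add: bij_betw_def)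
    show "(x, y) \<in> parcs G \<longleftrightarrow> (?f x, ?f y) \<in> parcs H" if "x \<in> pverts G" "y \<in> pverts G" for x y
      using that sub unfolding A' by (auto dest: inj_onD[OF inj])
  qed
qed

text \<open>The parametrisation runs from the abstract graph to the group, so that maps out of disjoint
  sums and products can be glued.\<close>

lemma commuting_graph_iso_iff:
  assumes "parcs X \<subseteq> pverts X \<times> pverts X"
  shows "commuting_graph H \<Gamma> \<simeq>\<^sub>g X \<longleftrightarrow>
    (\<exists>g. bij_betw g (pverts X) \<Gamma> \<and> (\<forall>x\<in>pverts X. \<forall>y\<in>pverts X.
      (x, y) \<in> parcs X \<longleftrightarrow> x \<noteq> y \<and> g x \<otimes>\<^bsub>H\<^esub> g y = g y \<otimes>\<^bsub>H\<^esub> g x))"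
    (is "_ \<longleftrightarrow> (\<exists>g. ?P g)")
proof
  assume "commuting_graph H \<Gamma> \<simeq>\<^sub>g X"
  then obtain f where f: "bij_betw f \<Gamma> (pverts X)"
    "\<And>x y. x \<in> \<Gamma> \<Longrightarrow> y \<in> \<Gamma> \<Longrightarrow>
      (x, y) \<in> parcs (commuting_graph H \<Gamma>) \<longleftrightarrow> (f x, f y) \<in> parcs X"
    by (rule with_proj_isoE) (auto simp: commuting_graph_def)
  let ?g = "inv_into \<Gamma> f"
  have g: "bij_betw ?g (pverts X) \<Gamma>"
    using f(1) by (rule bij_betw_inv_into)
  have gm: "?g x \<in> \<Gamma>" and fg: "f (?g x) = x" if "x \<in> pverts X" for x
    using that f(1) by (auto simp: bij_betw_def inv_into_into f_inv_into_f)
  have "(x, y) \<in> parcs X \<longleftrightarrow> x \<noteq> y \<and> ?g x \<otimes>\<^bsub>H\<^esub> ?g y = ?g y \<otimes>\<^bsub>H\<^esub> ?g x"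
    if "x \<in> pverts X" "y \<in> pverts X" for x y
  proof -
    have "(x, y) \<in> parcs X \<longleftrightarrow> (?g x, ?g y) \<in> parcs (commuting_graph H \<Gamma>)"
      using f(2)[of "?g x" "?g y"] that gm fg by simp
    moreover have "?g x = ?g y \<longleftrightarrow> x = y"
      using that fg by metis
    ultimately show ?thesis
      using that gm by (simp add: commuting_graph_def)
  qed
  with g show "\<exists>g. ?P g" by blast
next
  assume "\<exists>g. ?P g"
  then obtain g where g: "bij_betw g (pverts X) \<Gamma>"
    and arcs: "\<And>x y. x \<in> pverts X \<Longrightarrow> y \<in> pverts X \<Longrightarrow>
      (x, y) \<in> parcs X \<longleftrightarrow> x \<noteq> y \<and> g x \<otimes>\<^bsub>H\<^esub> g y = g y \<otimes>\<^bsub>H\<^esub> g x"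
    by blast
  let ?f = "inv_into (pverts X) g"
  have fm: "?f x \<in> pverts X" and gf: "g (?f x) = x" if "x \<in> \<Gamma>" for x
    using that g by (auto simp: bij_betw_def inv_into_into f_inv_into_f)
  show "commuting_graph H \<Gamma> \<simeq>\<^sub>g X"
  proof (rule with_proj_isoI[of _ _ ?f])
    show "bij_betw ?f (pverts (commuting_graph H \<Gamma>)) (pverts X)"
      using bij_betw_inv_into[OF g] by (simp add: commuting_graph_def)
    show "(x, y) \<in> parcs (commuting_graph H \<Gamma>) \<longleftrightarrow> (?f x, ?f y) \<in> parcs X"
      if "x \<in> pverts (commuting_graph H \<Gamma>)" "y \<in> pverts (commuting_graph H \<Gamma>)" for x y
    proof -
      have xy: "x \<in> \<Gamma>" "y \<in> \<Gamma>" using that by (simp_all add: commuting_graph_def)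
      then have "?f x = ?f y \<longleftrightarrow> x = y" using gf by metis
      with xy show ?thesis
        by (simp add: arcs[OF fm[OF xy(1)] fm[OF xy(2)]] gf commuting_graph_def)
    qed
  qed (use assms in \<open>auto simp: commuting_graph_def\<close>)
qed

section \<open>Gluing commuting graphs along blocks\<close>

definition commute_sets :: "('a, 'm) monoid_scheme \<Rightarrow> 'a set \<Rightarrow> 'a set \<Rightarrow> bool" where
  "commute_sets H A B \<longleftrightarrow> (\<forall>a\<in>A. \<forall>b\<in>B. a \<otimes>\<^bsub>H\<^esub> b = b \<otimes>\<^bsub>H\<^esub> a)"

definition nowhere_commute :: "('a, 'm) monoid_scheme \<Rightarrow> 'a set \<Rightarrow> 'a set \<Rightarrow> bool" where
  "nowhere_commute H A B \<longleftrightarrow> (\<forall>a\<in>A. \<forall>b\<in>B. a \<otimes>\<^bsub>H\<^esub> b \<noteq> b \<otimes>\<^bsub>H\<^esub> a)"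

text \<open>An element of both sets would commute with itself.\<close>

lemma nowhere_commute_disjoint: "nowhere_commute H A B \<Longrightarrow> A \<inter> B = {}"
  by (auto simp: nowhere_commute_def)

text \<open>Any enumeration of \<open>\<Gamma>\<close> is an isomorphism, because adjacency on both
  sides reduces to being distinct.\<close>

lemma commuting_graph_complete:
  assumes "finite \<Gamma>" "commute_sets H \<Gamma> \<Gamma>" "card \<Gamma> = m"
  shows "commuting_graph H \<Gamma> \<simeq>\<^sub>g complete_graph m"
proof -
  obtain g where g: "bij_betw g {..<m} \<Gamma>"
    using ex_bij_betw_nat_finite[OF assms(1)] assms(3) by (auto simp: atLeast0LessThan)
  have arcs: "(i, j) \<in> parcs (complete_graph m) \<longleftrightarrow> i \<noteq> j \<and> g i \<otimes>\<^bsub>H\<^esub> g j = g j \<otimes>\<^bsub>H\<^esub> g i"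
    if "i < m" "j < m" for i j
    using that assms(2) bij_betwE[OF g] by (simp add: complete_graph_def commute_sets_def)
  show ?thesis
    by (subst commuting_graph_iso_iff)
      (use g arcs in \<open>auto simp: complete_graph_def\<close>)
qed

lemma bij_betw_case_sum:
  assumes "bij_betw f A C" "bij_betw g B D" "C \<inter> D = {}"
  shows "bij_betw (case_sum f g) (A <+> B) (C \<union> D)"
proof -
  have "inj_on (case_sum f g) (A <+> B)"
  proof (rule inj_onI, elim PlusE)
    fix u v a b
    assume *: "case_sum f g u = case_sum f g v" "u = Inl a" "v = Inr b" "a \<in> A" "b \<in> B"
    then show "u = v" using assms bij_betwE[OF assms(1)] bij_betwE[OF assms(2)] by auto
  next
    fix u v a b
    assume *: "case_sum f g u = case_sum f g v" "u = Inr b" "v = Inl a" "a \<in> A" "b \<in> B"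
    then have "f a = g b" by simp
    with * show "u = v" using assms bij_betwE[OF assms(1)] bij_betwE[OF assms(2)] by auto
  qed (use assms in \<open>auto simp: bij_betw_def dest: inj_onD\<close>)
  moreover have "case_sum f g ` (A <+> B) = f ` A \<union> g ` B"
    by (simp add: Plus_def image_Un image_image)
  ultimately show ?thesis
    using assms by (simp add: bij_betw_def)
qed

text \<open>The hypothesis \<open>AB\<close> serves twice: it makes the sets disjoint, so that the
  bijections glue, and it rules out edges between them.\<close>

lemma commuting_graph_disjoint_union:
  assumes X: "parcs X \<subseteq> pverts X \<times> pverts X" and Y: "parcs Y \<subseteq> pverts Y \<times> pverts Y"
    and A: "commuting_graph H A \<simeq>\<^sub>g X" and B: "commuting_graph H B \<simeq>\<^sub>g Y"
    and AB: "nowhere_commute H A B"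
  shows "commuting_graph H (A \<union> B) \<simeq>\<^sub>g disjoint_union X Y"
proof -
  obtain f where f: "bij_betw f (pverts X) A" "\<forall>x\<in>pverts X. \<forall>y\<in>pverts X.
      (x, y) \<in> parcs X \<longleftrightarrow> x \<noteq> y \<and> f x \<otimes>\<^bsub>H\<^esub> f y = f y \<otimes>\<^bsub>H\<^esub> f x"
    using A unfolding commuting_graph_iso_iff[OF X] by blast
  obtain g where g: "bij_betw g (pverts Y) B" "\<forall>x\<in>pverts Y. \<forall>y\<in>pverts Y.
      (x, y) \<in> parcs Y \<longleftrightarrow> x \<noteq> y \<and> g x \<otimes>\<^bsub>H\<^esub> g y = g y \<otimes>\<^bsub>H\<^esub> g x"
    using B unfolding commuting_graph_iso_iff[OF Y] by blast
  have ne: "f x \<otimes>\<^bsub>H\<^esub> g y \<noteq> g y \<otimes>\<^bsub>H\<^esub> f x" "g y \<otimes>\<^bsub>H\<^esub> f x \<noteq> f x \<otimes>\<^bsub>H\<^esub> g y"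
    if "x \<in> pverts X" "y \<in> pverts Y" for x y
    using AB bij_betwE[OF f(1)] bij_betwE[OF g(1)] that unfolding nowhere_commute_def by metis+
  have wf: "parcs (disjoint_union X Y) \<subseteq> pverts (disjoint_union X Y) \<times> pverts (disjoint_union X Y)"
    using X Y by (auto simp: disjoint_union_def)
  have "bij_betw (case_sum f g) (pverts (disjoint_union X Y)) (A \<union> B)"
    using bij_betw_case_sum[OF f(1) g(1) nowhere_commute_disjoint[OF AB]]
    by (simp add: disjoint_union_def)
  then show ?thesis
    unfolding commuting_graph_iso_iff[OF wf]
    by (intro exI[of _ "case_sum f g"] conjI ballI)
      (use f(2) g(2) ne in \<open>auto simp: disjoint_union_def\<close>)
qed

text \<open>Sets that commute with each other may overlap, so disjointness is assumed separately
  here.\<close>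

lemma commuting_graph_join:
  assumes X: "parcs X \<subseteq> pverts X \<times> pverts X" and Y: "parcs Y \<subseteq> pverts Y \<times> pverts Y"
    and A: "commuting_graph H A \<simeq>\<^sub>g X" and B: "commuting_graph H B \<simeq>\<^sub>g Y"
    and AB: "commute_sets H A B" "A \<inter> B = {}"
  shows "commuting_graph H (A \<union> B) \<simeq>\<^sub>g graph_join X Y"
proof -
  obtain f where f: "bij_betw f (pverts X) A" "\<forall>x\<in>pverts X. \<forall>y\<in>pverts X.
      (x, y) \<in> parcs X \<longleftrightarrow> x \<noteq> y \<and> f x \<otimes>\<^bsub>H\<^esub> f y = f y \<otimes>\<^bsub>H\<^esub> f x"
    using A unfolding commuting_graph_iso_iff[OF X] by blast
  obtain g where g: "bij_betw g (pverts Y) B" "\<forall>x\<in>pverts Y. \<forall>y\<in>pverts Y.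
      (x, y) \<in> parcs Y \<longleftrightarrow> x \<noteq> y \<and> g x \<otimes>\<^bsub>H\<^esub> g y = g y \<otimes>\<^bsub>H\<^esub> g x"
    using B unfolding commuting_graph_iso_iff[OF Y] by blast
  have eq: "f x \<otimes>\<^bsub>H\<^esub> g y = g y \<otimes>\<^bsub>H\<^esub> f x" if "x \<in> pverts X" "y \<in> pverts Y" for x y
    using AB(1) bij_betwE[OF f(1)] bij_betwE[OF g(1)] that unfolding commute_sets_def by blast
  have wf: "parcs (graph_join X Y) \<subseteq> pverts (graph_join X Y) \<times> pverts (graph_join X Y)"
    using X Y by (auto simp: graph_join_def disjoint_union_def)
  have "bij_betw (case_sum f g) (pverts (graph_join X Y)) (A \<union> B)"
    using bij_betw_case_sum[OF f(1) g(1) AB(2)] by (simp add: graph_join_def)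
  then show ?thesis
    unfolding commuting_graph_iso_iff[OF wf]
    by (intro exI[of _ "case_sum f g"] conjI ballI)
      (use f(2) g(2) eq in \<open>auto simp: graph_join_def disjoint_union_def\<close>)
qed

text \<open>Each block has its own parametrisation \<open>g i\<close>. Failure of commutation across
  blocks gives both the injectivity of the combined map and the absence of edges between
  copies.\<close>

lemma commuting_graph_copies:
  assumes X: "parcs X \<subseteq> pverts X \<times> pverts X"
    and A: "\<And>i. i < k \<Longrightarrow> commuting_graph H (A i) \<simeq>\<^sub>g X"
    and sep: "\<And>i j. i < j \<Longrightarrow> j < k \<Longrightarrow> nowhere_commute H (A i) (A j)"
  shows "commuting_graph H (\<Union>i<k. A i) \<simeq>\<^sub>g graph_copies k X"
proof -
  have "\<exists>g. bij_betw g (pverts X) (A i) \<and> (\<forall>x\<in>pverts X. \<forall>y\<in>pverts X.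
      (x, y) \<in> parcs X \<longleftrightarrow> x \<noteq> y \<and> g x \<otimes>\<^bsub>H\<^esub> g y = g y \<otimes>\<^bsub>H\<^esub> g x)" if "i < k" for i
    using A[OF that] unfolding commuting_graph_iso_iff[OF X] .
  then obtain g where g: "\<And>i. i < k \<Longrightarrow> bij_betw (g i) (pverts X) (A i)"
    and arcs: "\<And>i x y. i < k \<Longrightarrow> x \<in> pverts X \<Longrightarrow> y \<in> pverts X \<Longrightarrow>
      (x, y) \<in> parcs X \<longleftrightarrow> x \<noteq> y \<and> g i x \<otimes>\<^bsub>H\<^esub> g i y = g i y \<otimes>\<^bsub>H\<^esub> g i x"
    by metis
  have gm: "g i x \<in> A i" if "i < k" "x \<in> pverts X" for i x
    using bij_betwE[OF g[OF that(1)]] that(2) by blast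
  have ne: "g i x \<otimes>\<^bsub>H\<^esub> g j y \<noteq> g j y \<otimes>\<^bsub>H\<^esub> g i x"
    if "i \<noteq> j" "i < k" "j < k" "x \<in> pverts X" "y \<in> pverts X" for i j x y
  proof (cases "i < j")
    case True
    then show ?thesis
      using sep[of i j] gm that unfolding nowhere_commute_def by blast
  next
    case False
    then have "nowhere_commute H (A j) (A i)"
      using sep[of j i] that by simp
    then show ?thesis
      using gm[of i x] gm[of j y] that unfolding nowhere_commute_def by metis
  qed
  have wf: "parcs (graph_copies k X) \<subseteq> pverts (graph_copies k X) \<times> pverts (graph_copies k X)"
    using X by (auto simp: graph_copies_def)
  let ?g = "\<lambda>(i, x). g i x"
  have "inj_on ?g ({..<k} \<times> pverts X)"
  proof (rule inj_onI, clarify)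
    fix i x j y assume *: "i < k" "x \<in> pverts X" "j < k" "y \<in> pverts X" "g i x = g j y"
    \<comment> \<open>For different indices \<open>ne\<close> would say that this common element
      does not commute with itself.\<close>
    then have "i = j" using ne[of i j x y] by auto
    with * show "i = j \<and> x = y" using g[of j] by (auto simp: bij_betw_def inj_on_def)
  qed
  moreover have "?g ` ({..<k} \<times> pverts X) = (\<Union>i<k. A i)"
  proof -
    have "?g ` ({..<k} \<times> pverts X) = (\<Union>i<k. g i ` pverts X)"
      by force
    then show ?thesis
      using g by (auto simp: bij_betw_def)
  qed
  ultimately have "bij_betw ?g (pverts (graph_copies k X)) (\<Union>i<k. A i)"
    by (simp add: bij_betw_def graph_copies_def)
  moreover have "((i, x), (j, y)) \<in> parcs (graph_copies k X) \<longleftrightarrow>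
      (i, x) \<noteq> (j, y) \<and> g i x \<otimes>\<^bsub>H\<^esub> g j y = g j y \<otimes>\<^bsub>H\<^esub> g i x"
    if "i < k" "x \<in> pverts X" "j < k" "y \<in> pverts X" for i x j y
    using that arcs[of i x y] ne[of i j x y] by (cases "i = j") (auto simp: graph_copies_def)
  ultimately show ?thesis
    unfolding commuting_graph_iso_iff[OF wf]
    by (intro exI[of _ ?g] conjI ballI) (auto simp: graph_copies_def)
qed

section \<open>The normal form\<close>

text \<open>The products give \<open>j i j = i\<close>. Multiplying by \<open>j\<close> on the left
  yields \<open>j i = z (i j)\<close>, and on the right \<open>z (j i) = i j\<close>; the two
  combine. Cancelling \<open>i j\<close> is left to the group setting.\<close>

lemma (in monoid) quaternion_square_order_two:
  assumes carr: "i \<in> carrier G" "j \<in> carrier G" "k \<in> carrier G"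
    and squares: "i \<otimes> i = z" "j \<otimes> j = z"
    and prods: "i \<otimes> j = k" "j \<otimes> k = i"
    and central: "\<And>x. x \<in> carrier G \<Longrightarrow> z \<otimes> x = x \<otimes> z"
  shows "z \<otimes> z \<otimes> (i \<otimes> j) = i \<otimes> j"
proof -
  have z: "z \<in> carrier G" using carr squares by blast
  have i: "j \<otimes> i \<otimes> j = i" using prods carr by (simp add: m_assoc)
  have ji: "j \<otimes> i = z \<otimes> (i \<otimes> j)"
    using arg_cong[OF i, of "\<lambda>x. j \<otimes> x"] squares carr z by (simp flip: m_assoc)
  have "z \<otimes> (j \<otimes> i) = j \<otimes> i \<otimes> j \<otimes> j"
    using squares carr z central[of "j \<otimes> i"] by (simp add: m_assoc)
  also have "\<dots> = i \<otimes> j"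
    using i by simp
  finally show ?thesis
    using ji z carr by (simp add: m_assoc)
qed

lemma (in group) commute_inv:
  assumes "x \<in> carrier G" "y \<in> carrier G" "x \<otimes> y = y \<otimes> x"
  shows "x \<otimes> inv y = inv y \<otimes> x"
proof -
  have "inv y \<otimes> (x \<otimes> y) \<otimes> inv y = inv y \<otimes> x"
    using assms(1,2) by (simp add: m_assoc)
  then show ?thesis
    unfolding assms(3) using assms(1,2) by (simp flip: m_assoc)
qed

section \<open>The presentation on the two generators \<open>s\<close> and \<open>t\<close>, and its
  central element\<close>

locale octahedral_pair = group G for G (structure) +
  fixes s t
  assumes s_carrier [simp]: "s \<in> carrier G" and t_carrier [simp]: "t \<in> carrier G"
    and tst: "t \<otimes> s \<otimes> t = s \<otimes> s" and sts: "s \<otimes> t \<otimes> s = t \<otimes> t \<otimes> t"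
    and s3: "s \<otimes> s \<otimes> s = t \<otimes> t \<otimes> t \<otimes> t"
    and generated: "carrier G = generate G {s, t}"
begin

abbreviation z where "z \<equiv> t \<otimes> t \<otimes> t \<otimes> t"

lemma zs: "z \<otimes> s = s \<otimes> z"
  unfolding s3[symmetric] by (simp add: m_assoc)

text \<open>By \<open>s3\<close> the element \<open>z\<close> is a power of each generator, so it
  commutes with both; this passes to inverses and products.\<close>

lemma z_central: "x \<in> carrier G \<Longrightarrow> z \<otimes> x = x \<otimes> z"
  unfolding generated
proof (induction rule: generate.induct)
  case (incl h)
  then show ?case using zs by (auto simp: m_assoc)
next
  case (inv h)
  then have h: "h \<in> carrier G" and c: "z \<otimes> h = h \<otimes> z" using zs by (auto simp: m_assoc)
  show ?case
    using commute_inv[OF _ h c] by simp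
next
  case (eng h1 h2)
  then have "h1 \<in> carrier G" "h2 \<in> carrier G" unfolding generated by auto
  with eng.IH show ?case using m_assoc[of z h1 h2] m_assoc[of h1 z h2] m_assoc[of h1 h2 z] by simp
qed simp

text \<open>The conjugates of \<open>t\<^sup>2\<close> by the powers of \<open>s\<close> multiply like \<open>i, j, k\<close> in the quaternion group.\<close>

lemma z_square: "z \<otimes> z = \<one>"
proof -
  let ?S = "inv s"
  define \<phi> where "\<phi> x = s \<otimes> x \<otimes> ?S" for x
  have \<phi>_mult: "\<phi> (x \<otimes> y) = \<phi> x \<otimes> \<phi> y" if "x \<in> carrier G" "y \<in> carrier G" for x y
    using that by (simp add: \<phi>_def m_assoc inv_solve_left' flip: m_assoc[of ?S])
  have \<phi>_closed: "\<phi> x \<in> carrier G" if "x \<in> carrier G" for x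
    using that by (simp add: \<phi>_def)
  have \<phi>_z: "\<phi> z = z"
    unfolding \<phi>_def zs[symmetric] by (simp add: m_assoc)
  define i where "i = t \<otimes> t"
  define j where "j = \<phi> i"
  define k where "k = \<phi> j"
  have carr: "i \<in> carrier G" "j \<in> carrier G" "k \<in> carrier G"
    by (simp_all add: i_def j_def k_def \<phi>_closed)
  have ii: "i \<otimes> i = z" by (simp add: i_def m_assoc)
  have jj: "j \<otimes> j = z"
    using \<phi>_mult[of i i] carr ii \<phi>_z by (simp add: j_def)
  \<comment> \<open>This is \<open>sts\<close> multiplied on the right by the inverse of
    \<open>s\<close> twice.\<close>
  have stS: "s \<otimes> t \<otimes> ?S = t \<otimes> t \<otimes> t \<otimes> ?S \<otimes> ?S"
    unfolding sts[symmetric] by (simp add: m_assoc)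
  \<comment> \<open>Rewriting by \<open>tst\<close>, \<open>stS\<close> and \<open>tst\<close> again
    collects the powers of \<open>t\<close> between \<open>s s\<close> and \<open>?S ?S\<close>,
    which is the twofold conjugate \<open>k\<close>.\<close>
  have ij: "i \<otimes> j = k"
  proof -
    have "i \<otimes> j = t \<otimes> (t \<otimes> s \<otimes> t) \<otimes> t \<otimes> ?S"
      by (simp add: i_def j_def \<phi>_def m_assoc)
    also have "\<dots> = t \<otimes> s \<otimes> (s \<otimes> t \<otimes> ?S)"
      unfolding tst by (simp add: m_assoc)
    also have "\<dots> = (t \<otimes> s \<otimes> t) \<otimes> t \<otimes> t \<otimes> ?S \<otimes> ?S"
      unfolding stS by (simp add: m_assoc)
    also have "\<dots> = k"
      unfolding tst by (simp add: i_def j_def k_def \<phi>_def m_assoc)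
    finally show ?thesis .
  qed
  \<comment> \<open>Three conjugations by \<open>s\<close> amount to conjugation by
    \<open>s s s\<close>, which equals the central \<open>z\<close>.\<close>
  have \<phi>k: "\<phi> k = i"
  proof -
    have "\<phi> k = (s \<otimes> s \<otimes> s) \<otimes> i \<otimes> (?S \<otimes> ?S \<otimes> ?S)"
      using carr(1) by (simp add: j_def k_def \<phi>_def m_assoc)
    also have "\<dots> = i \<otimes> (s \<otimes> s \<otimes> s) \<otimes> (?S \<otimes> ?S \<otimes> ?S)"
      unfolding s3 z_central[OF carr(1)] ..
    also have "\<dots> = i"
      using carr(1) by (simp add: m_assoc) (simp flip: m_assoc)
    finally show ?thesis .
  qed
  \<comment> \<open>The image of \<open>ij\<close> under \<open>\<phi>\<close>, which permutes
    \<open>i\<close>, \<open>j\<close>, \<open>k\<close> cyclically.\<close>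
  have jk: "j \<otimes> k = i"
    using \<phi>_mult[of i j] carr ij \<phi>k by (simp add: j_def k_def)
  have "z \<otimes> z \<otimes> k = k"
    using quaternion_square_order_two[OF carr ii jj ij jk z_central] ij by simp
  then show ?thesis
    using carr by simp
qed

text \<open>Together with \<open>inv_s\<close>, this turns inverses of the generators into positive
  powers, so that the coset enumeration only has to treat right multiplication by \<open>s\<close>
  and \<open>t\<close>.\<close>

lemma inv_t: "inv t = t [^] (7::nat)"
proof (rule inv_equality)
  show "t [^] (7::nat) \<otimes> t = \<one>"
    using z_square by (simp add: numeral_eq_Suc m_assoc)
qed simp_all

lemma inv_s: "inv s = s \<otimes> s \<otimes> s \<otimes> s \<otimes> s"
proof (rule inv_equality)
  show "s \<otimes> s \<otimes> s \<otimes> s \<otimes> s \<otimes> s = \<one>"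
    using z_square unfolding s3[symmetric] by (simp add: m_assoc)
qed simp_all

text \<open>The six right cosets of the subgroup generated by \<open>t\<close> are represented by \<open>reps\<close>.\<close>

definition reps :: "'a set" where
  "reps = {\<one>, s, s \<otimes> t, s \<otimes> t \<otimes> t, s \<otimes> t \<otimes> t \<otimes> t, s \<otimes> t \<otimes> t \<otimes> t \<otimes> s}"

text \<open>Eight exponents suffice because \<open>t\<close> to the eighth power is
  \<open>\<one>\<close>. Nothing here says that the 48 products are distinct; they yield the upper
  bound on the order.\<close>

definition normal_forms :: "'a set" where
  "normal_forms = (\<lambda>(k, c). t [^] k \<otimes> c) ` ({..<8::nat} \<times> reps)"

lemma reps_closed: "c \<in> reps \<Longrightarrow> c \<in> carrier G"
  by (auto simp: reps_def)

lemma t_pow_8: "t [^] (8::nat) = \<one>"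
  using z_square by (simp add: numeral_eq_Suc m_assoc)

lemma normal_formsI:
  assumes "c \<in> reps"
  shows "t [^] (k::nat) \<otimes> c \<in> normal_forms"
proof -
  have "t [^] k = t [^] (8 * (k div 8) + k mod 8)" by simp
  also have "\<dots> = t [^] (k mod 8)"
    by (simp only: nat_pow_mult[symmetric] nat_pow_pow[symmetric] t_carrier) (simp add: t_pow_8)
  finally show ?thesis
    using assms by (auto simp: normal_forms_def intro!: image_eqI[of _ _ "(k mod 8, c)"])
qed

text \<open>Right multiplication leaves the power of \<open>t\<close> in front untouched, so only
  the six representatives have to be checked, as in a coset table.\<close>

lemma normal_forms_mult:
  assumes x: "x \<in> normal_forms" and u: "u \<in> carrier G"
    and step: "\<And>c. c \<in> reps \<Longrightarrow> c \<otimes> u \<in> normal_forms"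
  shows "x \<otimes> u \<in> normal_forms"
proof -
  obtain k c where kc: "x = t [^] (k::nat) \<otimes> c" "c \<in> reps"
    using x by (auto simp: normal_forms_def)
  obtain l d where ld: "c \<otimes> u = t [^] (l::nat) \<otimes> d" "d \<in> reps"
    using step[OF kc(2)] by (auto simp: normal_forms_def)
  have "x \<otimes> u = t [^] k \<otimes> (c \<otimes> u)"
    using kc u reps_closed by (simp add: m_assoc)
  also have "\<dots> = t [^] (k + l) \<otimes> d"
    using ld reps_closed by (simp add: nat_pow_mult[symmetric] m_assoc)
  finally show ?thesis
    using normal_formsI[OF ld(2)] by simp
qed

lemma reps_normal_forms:
  fixes k :: nat
  shows "t [^] k \<in> normal_forms" "t [^] k \<otimes> s \<in> normal_forms" "t [^] k \<otimes> (s \<otimes> t) \<in> normal_forms"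
    "t [^] k \<otimes> (s \<otimes> t \<otimes> t) \<in> normal_forms" "t [^] k \<otimes> (s \<otimes> t \<otimes> t \<otimes> t) \<in> normal_forms"
    "t [^] k \<otimes> (s \<otimes> t \<otimes> t \<otimes> t \<otimes> s) \<in> normal_forms"
  using normal_formsI[of \<one> k] by (auto intro!: normal_formsI simp: reps_def)

lemma reps_subset_normal_forms: "c \<in> reps \<Longrightarrow> c \<in> normal_forms"
  using normal_formsI[of c 0] reps_closed by simp

text \<open>On the cosets, \<open>t\<close> fixes the first and the last and permutes the middle
  four cyclically; \<open>wrap\<close> and \<open>last\<close> are the table entries that need an
  argument.\<close>

lemma normal_forms_mult_t:
  assumes "x \<in> normal_forms"
  shows "x \<otimes> t \<in> normal_forms"
proof (rule normal_forms_mult[OF assms t_carrier])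
  \<comment> \<open>An extra \<open>t\<close> on the left creates two factors \<open>t s t\<close>;
    it is removed at the end as the seventh power of \<open>t\<close>.\<close>
  have last: "s \<otimes> t \<otimes> t \<otimes> t \<otimes> s \<otimes> t = t [^] (7::nat) \<otimes> (s \<otimes> t \<otimes> t \<otimes> t \<otimes> s)"
  proof -
    have "t \<otimes> (s \<otimes> t \<otimes> t \<otimes> t \<otimes> s \<otimes> t) = (t \<otimes> s \<otimes> t) \<otimes> t \<otimes> (t \<otimes> s \<otimes> t)"
      by (simp add: m_assoc)
    also have "\<dots> = s \<otimes> (s \<otimes> t \<otimes> s) \<otimes> s"
      unfolding tst by (simp add: m_assoc)
    finally have "t \<otimes> (s \<otimes> t \<otimes> t \<otimes> t \<otimes> s \<otimes> t) = s \<otimes> t \<otimes> t \<otimes> t \<otimes> s"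
      unfolding sts by (simp add: m_assoc)
    then show ?thesis
      unfolding inv_t[symmetric] by (simp add: inv_solve_left)
  qed
  have wrap: "s \<otimes> t \<otimes> t \<otimes> t \<otimes> t = t [^] (4::nat) \<otimes> s"
    using zs by (simp add: numeral_eq_Suc m_assoc)
  show "c \<otimes> t \<in> normal_forms" if "c \<in> reps" for c
    using that reps_subset_normal_forms reps_normal_forms(1)[of 1] unfolding reps_def
    by (elim insertE emptyE) (simp_all add: wrap last reps_normal_forms)
qed

text \<open>On the cosets, \<open>s\<close> acts by two cycles of length three: the cosets of
  \<open>\<one>\<close>, \<open>s\<close>, \<open>s t\<close> and the remaining three.\<close>

lemma normal_forms_mult_s:
  assumes "x \<in> normal_forms"
  shows "x \<otimes> s \<in> normal_forms"
proof (rule normal_forms_mult[OF assms s_carrier])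
  have "t \<otimes> (s \<otimes> t \<otimes> t \<otimes> s) = (t \<otimes> s \<otimes> t) \<otimes> t \<otimes> s"
    by (simp add: m_assoc)
  also have "\<dots> = s \<otimes> (s \<otimes> t \<otimes> s)"
    unfolding tst by (simp add: m_assoc)
  finally have "t \<otimes> (s \<otimes> t \<otimes> t \<otimes> s) = s \<otimes> t \<otimes> t \<otimes> t"
    unfolding sts by (simp add: m_assoc)
  then have stts: "s \<otimes> t \<otimes> t \<otimes> s = t [^] (7::nat) \<otimes> (s \<otimes> t \<otimes> t \<otimes> t)"
    unfolding inv_t[symmetric] by (simp add: inv_solve_left)
  have ss: "s \<otimes> s = t [^] (1::nat) \<otimes> (s \<otimes> t)"
    using tst by (simp add: m_assoc)
  have st_s: "s \<otimes> t \<otimes> s = t [^] (3::nat)"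
    by (simp add: sts numeral_eq_Suc)
  \<comment> \<open>Replacing \<open>s s\<close> by \<open>t s t\<close> completes the power
    \<open>z\<close>, which is central and moves to the front.\<close>
  have last: "s \<otimes> t \<otimes> t \<otimes> t \<otimes> s \<otimes> s = t [^] (5::nat) \<otimes> (s \<otimes> t \<otimes> t)"
  proof -
    have "s \<otimes> t \<otimes> t \<otimes> t \<otimes> s \<otimes> s = s \<otimes> t \<otimes> t \<otimes> t \<otimes> (t \<otimes> s \<otimes> t)"
      unfolding tst by (simp add: m_assoc)
    also have "\<dots> = (s \<otimes> z) \<otimes> s \<otimes> t"
      by (simp add: m_assoc)
    also have "\<dots> = z \<otimes> (s \<otimes> s) \<otimes> t"
      unfolding zs[symmetric] by (simp add: m_assoc)
    also have "\<dots> = z \<otimes> (t \<otimes> s \<otimes> t) \<otimes> t"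
      unfolding tst ..
    finally show ?thesis
      by (simp add: numeral_eq_Suc m_assoc)
  qed
  show "c \<otimes> s \<in> normal_forms" if "c \<in> reps" for c
    using that reps_subset_normal_forms reps_normal_forms(3)[of 1] unfolding reps_def
    by (elim insertE emptyE) (simp_all add: ss st_s stts last reps_normal_forms)
qed

lemma normal_forms_mult_t_pow: "x \<in> normal_forms \<Longrightarrow> x \<otimes> t [^] (k::nat) \<in> normal_forms"
proof (induction k)
  case 0
  then show ?case by (auto simp: normal_forms_def reps_closed)
next
  case (Suc k)
  moreover have "x \<in> carrier G" using Suc.prems by (auto simp: normal_forms_def reps_closed)
  ultimately show ?case using normal_forms_mult_t by (simp flip: m_assoc)
qed

lemma normal_forms_closed: "x \<in> normal_forms \<Longrightarrow> x \<in> carrier G"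
  by (auto simp: normal_forms_def reps_closed)

lemma carrier_subset_normal_forms: "carrier G \<subseteq> normal_forms"
proof
  fix x assume "x \<in> carrier G"
  then have "x \<in> generate G {s, t}" using generated by simp
  \<comment> \<open>The left factor \<open>y\<close> is kept arbitrary so that the case of a product
    can apply both induction hypotheses in turn; at the end \<open>y\<close> is
    \<open>\<one>\<close>.\<close>
  then have "\<And>y. y \<in> normal_forms \<Longrightarrow> y \<otimes> x \<in> normal_forms"
  proof (induction rule: generate.induct)
    case one
    then show ?case using normal_forms_closed by simp
  next
    case (incl h)
    then show ?case using normal_forms_mult_s normal_forms_mult_t by auto
  next
    case (inv h)
    then show ?case
      using normal_forms_mult_s normal_forms_mult_t_pow normal_forms_closed
      by (auto simp: inv_s inv_t simp flip: m_assoc)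
  next
    case (eng h1 h2)
    then have "h1 \<in> carrier G" "h2 \<in> carrier G" unfolding generated by auto
    with eng show ?case using normal_forms_closed by (simp flip: m_assoc)
  qed
  moreover have "\<one> \<in> normal_forms" using normal_formsI[of \<one> 0] by (simp add: reps_def)
  ultimately show "x \<in> normal_forms" using \<open>x \<in> carrier G\<close> by force
qed

lemma finite_carrier: "finite (carrier G)"
  and card_carrier_le: "card (carrier G) \<le> 48"
proof -
  \<comment> \<open>The length of a list bounds the cardinality even if some representatives
    coincide.\<close>
  let ?reps = "[\<one>, s, s \<otimes> t, s \<otimes> t \<otimes> t, s \<otimes> t \<otimes> t \<otimes> t, s \<otimes> t \<otimes> t \<otimes> t \<otimes> s]"
  have reps: "reps = set ?reps"
    by (simp add: reps_def)
  then have "card reps \<le> 6"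
    using card_length[of ?reps] by (simp only: list.size)
  moreover have fin: "finite ({..<8::nat} \<times> reps)"
    by (simp add: reps)
  then have "card normal_forms \<le> card ({..<8::nat} \<times> reps)"
    unfolding normal_forms_def by (rule card_image_le)
  ultimately have "card normal_forms \<le> 48"
    by (simp only: card_cartesian_product card_lessThan)
  moreover have "finite normal_forms"
    unfolding normal_forms_def using fin by (rule finite_imageI)
  ultimately show "finite (carrier G)" "card (carrier G) \<le> 48"
    using finite_subset[OF carrier_subset_normal_forms] card_mono[OF _ carrier_subset_normal_forms]
    by simp_all
qed

end

section \<open>A faithful matrix representation\<close>

text \<open>Cancelling \<open>bo_r\<close> in \<open>r r = r s t\<close> gives
  \<open>r = s t\<close>. Substituting this in \<open>r r = s s s\<close> and in
  \<open>t t t t = r s t\<close> and cancelling one letter gives \<open>tst\<close> and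
  \<open>sts\<close>.\<close>

lemma octahedral_pair_BO48: "octahedral_pair BO48 bo_s bo_t"
proof -
  interpret group BO48 by (rule group_BO48)
  have letter: "word_class BO_rels w \<in> carrier BO48" for w
    by (simp add: BO48_def carrier_presented_group)
  then have carr [simp]: "bo_r \<in> carrier BO48" "bo_s \<in> carrier BO48" "bo_t \<in> carrier BO48"
    by (simp_all add: bo_r_def bo_s_def bo_t_def generator_def)
  have rr: "bo_r \<star> bo_r = bo_s \<star> bo_s \<star> bo_s"
    and s3: "bo_s \<star> bo_s \<star> bo_s = bo_t \<star> bo_t \<star> bo_t \<star> bo_t"
    and t4: "bo_t \<star> bo_t \<star> bo_t \<star> bo_t = bo_r \<star> bo_s \<star> bo_t"
    using BO48_relations by (simp_all add: numeral_eq_Suc)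
  have "bo_r \<star> bo_r = bo_r \<star> (bo_s \<star> bo_t)"
    using rr s3 t4 by (simp add: m_assoc)
  then have r: "bo_r = bo_s \<star> bo_t"
    by simp
  have tst: "bo_t \<star> bo_s \<star> bo_t = bo_s \<star> bo_s"
  proof -
    have "bo_s \<star> (bo_t \<star> bo_s \<star> bo_t) = bo_s \<star> (bo_s \<star> bo_s)"
      using rr unfolding r by (simp add: m_assoc)
    then show ?thesis by simp
  qed
  have sts: "bo_s \<star> bo_t \<star> bo_s = bo_t \<star> bo_t \<star> bo_t"
    using t4 unfolding r by simp
  have "x \<in> generate BO48 {bo_s, bo_t}" if "x \<in> carrier BO48" for x
  proof -
    let ?H = "generate BO48 {bo_s, bo_t}"
    have sub: "subgroup ?H BO48" by (rule generate_is_subgroup) auto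
    have gens: "bo_s \<in> ?H" "bo_t \<in> ?H" by (auto intro: generate.incl)
    then have "bo_r \<in> ?H" unfolding r using subgroup.m_closed[OF sub] by blast
    with gens have gen: "generator BO_rels g \<in> ?H" for g
      by (cases g) (simp_all add: bo_r_def bo_s_def bo_t_def)
    \<comment> \<open>Every element of the group is the value of some word in the generators, so
      closure of the subgroup along a word suffices.\<close>
    have "eval_word BO48 (generator BO_rels) w \<in> ?H" for w
    proof (induction w)
      case Nil
      then show ?case using subgroup.one_closed[OF sub] by (simp add: eval_word_simps)
    next
      case (Cons a w)
      then show ?case
        using gen subgroup.m_closed[OF sub] subgroup.m_inv_closed[OF sub]
        by (cases a) (simp add: eval_word_simps)
    qed
    then show ?thesis
      using that word_class_eq_eval_word[of BO_rels]
      by (auto simp: BO48_def carrier_presented_group)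
  qed
  moreover have "generate BO48 {bo_s, bo_t} \<subseteq> carrier BO48"
    using generate_incl[of "{bo_s, bo_t}"] by auto
  ultimately have "carrier BO48 = generate BO48 {bo_s, bo_t}"
    by blast
  with s3 tst sts carr show ?thesis
    by (intro octahedral_pair.intro octahedral_pair_axioms.intro group_BO48)
qed

section \<open>Matrices of determinant one modulo seven\<close>

type_synonym mat2 = "int \<times> int \<times> int \<times> int"

text \<open>Products are reduced to entries from 0 to 6, so equality over the field is plain
  equality of tuples and can be decided by evaluation.\<close>

fun mat2_mult :: "mat2 \<Rightarrow> mat2 \<Rightarrow> mat2" where
  "mat2_mult (a, b, c, d) (a', b', c', d') =
    ((a * a' + b * c') mod 7, (a * b' + b * d') mod 7, (c * a' + d * c') mod 7, (c * b' + d * d') mod 7)"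

text \<open>\<open>(a, b, c, d)\<close> is the matrix with rows \<open>(a, b)\<close> and \<open>(c, d)\<close> over the field with seven
  elements. This field contains the square root \<open>3\<close> of \<open>2\<close>, so \<open>SL\<^sub>2\<close> over it has a subgroup
  isomorphic to the binary octahedral group.\<close>

definition SL2_7 :: "mat2 monoid" where
  "SL2_7 =
    \<lparr> carrier = {(a, b, c, d). a \<in> {0..<7} \<and> b \<in> {0..<7} \<and> c \<in> {0..<7} \<and> d \<in> {0..<7} \<and>
        (a * d - b * c) mod 7 = 1},
      monoid.mult = mat2_mult, one = (1, 0, 0, 1) \<rparr>"

lemma mult_SL2_7: "x \<otimes>\<^bsub>SL2_7\<^esub> y = mat2_mult x y" and one_SL2_7: "\<one>\<^bsub>SL2_7\<^esub> = (1, 0, 0, 1)"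
  by (simp_all add: SL2_7_def)

text \<open>Closure is the multiplicativity of the determinant modulo seven, and inverses are
  adjugates.\<close>

lemma group_SL2_7: "group SL2_7"
proof (rule groupI)
  \<comment> \<open>Otherwise linear arithmetic splits on every occurrence of \<open>mod\<close> and does not come back.\<close>
  note [[linarith_split_limit = 0]]
  fix x y assume xy: "x \<in> carrier SL2_7" "y \<in> carrier SL2_7"
  have det: "((a * a' + b * c') mod 7 * ((c * b' + d * d') mod 7)
      - (a * b' + b * d') mod 7 * ((c * a' + d * c') mod 7)) mod 7
      = ((a * d - b * c) mod 7 * ((a' * d' - b' * c') mod 7)) mod 7" for a b c d a' b' c' d' :: int
  proof -
    have "((a * a' + b * c') mod 7 * ((c * b' + d * d') mod 7)
        - (a * b' + b * d') mod 7 * ((c * a' + d * c') mod 7)) mod 7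
        = ((a * a' + b * c') * (c * b' + d * d') - (a * b' + b * d') * (c * a' + d * c')) mod 7"
      by (intro mod_diff_cong mod_mult_cong) simp_all
    also have "\<dots> = ((a * d - b * c) * (a' * d' - b' * c')) mod 7"
      by (simp add: algebra_simps)
    finally show ?thesis
      by (simp only: mod_mult_eq)
  qed
  obtain a b c d where x_eq: "x = (a, b, c, d)"
    by (rule prod_cases4)
  obtain a' b' c' d' where y_eq: "y = (a', b', c', d')"
    by (rule prod_cases4)
  have "(a * d - b * c) mod 7 = 1" "(a' * d' - b' * c') mod 7 = 1"
    using xy by (simp_all add: SL2_7_def x_eq y_eq)
  then have "((a * a' + b * c') mod 7 * ((c * b' + d * d') mod 7)
      - (a * b' + b * d') mod 7 * ((c * a' + d * c') mod 7)) mod 7 = 1"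
    unfolding det by simp
  then show "x \<otimes>\<^bsub>SL2_7\<^esub> y \<in> carrier SL2_7"
    by (simp add: SL2_7_def x_eq y_eq)
next
  note [[linarith_split_limit = 0]]
  \<comment> \<open>Dropping the inner reductions turns associativity into a polynomial identity
    over the integers.\<close>
  have distrib: "(p mod 7 * x + q mod 7 * y) mod 7 = (p * x + q * y) mod 7"
    "(x * (p mod 7) + y * (q mod 7)) mod 7 = (x * p + y * q) mod 7" for p q x y :: int
    by (intro mod_add_cong mod_mult_cong; simp)+
  fix x y u assume "x \<in> carrier SL2_7" "y \<in> carrier SL2_7" "u \<in> carrier SL2_7"
  show "x \<otimes>\<^bsub>SL2_7\<^esub> y \<otimes>\<^bsub>SL2_7\<^esub> u = x \<otimes>\<^bsub>SL2_7\<^esub> (y \<otimes>\<^bsub>SL2_7\<^esub> u)"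
    by (cases x; cases y; cases u)
      (simp only: mult_SL2_7 mat2_mult.simps distrib prod.inject, simp add: algebra_simps)
next
  note [[linarith_split_limit = 0]]
  fix x assume x: "x \<in> carrier SL2_7"
  then obtain a b c d where abcd: "x = (a, b, c, d)" "(a * d - b * c) mod 7 = 1"
    by (auto simp: SL2_7_def)
  \<comment> \<open>The adjugate, which is the inverse because the determinant is 1.\<close>
  let ?y = "(d, (- b) mod 7, (- c) mod 7, a)"
  have minus: "(p * q + (- u) mod 7 * v) mod 7 = (p * q - u * v) mod 7"
    "((- u) mod 7 * v + p * q) mod 7 = (p * q - u * v) mod 7"
    "(p * q - (- u) mod 7 * ((- v) mod 7)) mod 7 = (p * q - u * v) mod 7" for p q u v :: int
  proof -
    have u: "((- u) mod 7 * v) mod 7 = (- (u * v)) mod 7"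
      by (simp add: mod_mult_left_eq)
    show "(p * q + (- u) mod 7 * v) mod 7 = (p * q - u * v) mod 7"
      "((- u) mod 7 * v + p * q) mod 7 = (p * q - u * v) mod 7"
      using mod_add_cong[OF HOL.refl u, of "p * q"] by (simp_all add: add.commute)
    show "(p * q - (- u) mod 7 * ((- v) mod 7)) mod 7 = (p * q - u * v) mod 7"
      using mod_diff_cong[OF HOL.refl mod_mult_eq[of "- u" 7 "- v"], of "p * q"] by simp
  qed
  have "?y \<in> carrier SL2_7"
    using x abcd minus(3)[of d a b c] by (simp add: SL2_7_def mult.commute)
  moreover have "?y \<otimes>\<^bsub>SL2_7\<^esub> x = \<one>\<^bsub>SL2_7\<^esub>"
    using abcd(2) by (simp only: abcd(1) mult_SL2_7 one_SL2_7 mat2_mult.simps minus)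
      (simp add: mult.commute)
  ultimately show "\<exists>y\<in>carrier SL2_7. y \<otimes>\<^bsub>SL2_7\<^esub> x = \<one>\<^bsub>SL2_7\<^esub>" ..
qed (auto simp: SL2_7_def)

text \<open>The traces are 0, 1 and 4, where 4 is a square root of 2 modulo seven. With determinant
  1 this makes \<open>r r\<close>, \<open>s s s\<close> and \<open>t t t t\<close> all equal to the
  negative identity; moreover \<open>r\<close> is the product of \<open>s\<close> and
  \<open>t\<close>.\<close>

primrec gen_matrix :: "bo_gen \<Rightarrow> mat2" where
  "gen_matrix gen_r = (0, 3, 2, 0)"
| "gen_matrix gen_s = (3, 0, 1, 5)"
| "gen_matrix gen_t = (0, 1, 6, 4)"

text \<open>The inverses are tabulated so that words can be evaluated by computation.\<close>

primrec gen_matrix_inv :: "bo_gen \<Rightarrow> mat2" where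
  "gen_matrix_inv gen_r = (0, 4, 5, 0)"
| "gen_matrix_inv gen_s = (5, 0, 6, 3)"
| "gen_matrix_inv gen_t = (4, 6, 1, 0)"

definition word_matrix :: "bo_gen word \<Rightarrow> mat2" where
  "word_matrix w =
    foldr (\<lambda>(g, b). mat2_mult (if b then gen_matrix_inv g else gen_matrix g)) w (1, 0, 0, 1)"

lemma word_matrix_eval_word: "word_matrix w = eval_word SL2_7 gen_matrix w"
  and gen_matrix_closed: "gen_matrix g \<in> carrier SL2_7"
proof -
  interpret group SL2_7 by (rule group_SL2_7)
  have carr: "gen_matrix g \<in> carrier SL2_7" "gen_matrix_inv g \<in> carrier SL2_7" for g
    by (cases g; simp add: SL2_7_def)+
  then show "gen_matrix g \<in> carrier SL2_7" by blast
  have "gen_matrix_inv g \<otimes>\<^bsub>SL2_7\<^esub> gen_matrix g = \<one>\<^bsub>SL2_7\<^esub>" for g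
    by (cases g) (simp_all add: mult_SL2_7 one_SL2_7)
  then have "inv\<^bsub>SL2_7\<^esub> gen_matrix g = gen_matrix_inv g" for g
    using carr by (rule inv_equality)
  then show "word_matrix w = eval_word SL2_7 gen_matrix w"
    by (induction w) (auto simp: word_matrix_def eval_word_simps mult_SL2_7 one_SL2_7)
qed

lemma word_matrix_append: "word_matrix (u @ v) = mat2_mult (word_matrix u) (word_matrix v)"
  by (simp add: word_matrix_eval_word eval_word_append[OF group_SL2_7 gen_matrix_closed] mult_SL2_7)

text \<open>The matrices satisfy the three relations, by computation, so \<open>word_matrix\<close>
  is well defined on the group. Its injectivity comes later, by counting.\<close>

lemma word_matrix_cong:
  assumes "word_class BO_rels u = word_class BO_rels v"
  shows "word_matrix u = word_matrix v"
proof -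
  have "word_matrix u = word_matrix v" if "(u, v) \<in> BO_rels" for u v
  proof -
    have "word_matrix (replicate 2 (gen_r, False)) = word_matrix (replicate 3 (gen_s, False))"
      "word_matrix (replicate 3 (gen_s, False)) = word_matrix (replicate 4 (gen_t, False))"
      "word_matrix (replicate 4 (gen_t, False)) =
        word_matrix [(gen_r, False), (gen_s, False), (gen_t, False)]"
      by code_simp+
    then show ?thesis
      using that unfolding BO_rels_def by blast
  qed
  moreover have "(u, v) \<in> word_cong BO_rels"
    using assms by (simp only: word_class_eq_iff)
  ultimately show ?thesis
    unfolding word_matrix_eval_word by (rule eval_word_cong[OF group_SL2_7 gen_matrix_closed])
qed

section \<open>The blocks of the commuting graph\<close>

context
begin

private abbreviation (input) r where "r \<equiv> (gen_r, False)"
private abbreviation (input) s where "s \<equiv> (gen_s, False)"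
private abbreviation (input) t where "t \<equiv> (gen_t, False)"
private abbreviation (input) r' where "r' \<equiv> (gen_r, True)"
private abbreviation (input) s' where "s' \<equiv> (gen_s, True)"
private abbreviation (input) t' where "t' \<equiv> (gen_t, True)"

definition Z_words :: "bo_gen word list" where
  "Z_words = [[], [r, r]]"

text \<open>The first of the seven two-element sets is absent: it is the centre, listed as
  \<open>Z_words\<close>, and is joined to everything instead of being a block of its own.\<close>

definition B_words :: "bo_gen word list list" where
  "B_words = [[[r], [r']], [[t, s], [s', t']], [[s', t, s'], [s, t', s]], [[t', r', t], [t', r, t]],
    [[r', t, s, r], [r, t, s, r]], [[t', r', t, s], [t', r, t, s]]]"

definition C_words :: "bo_gen word list list" where
  "C_words = [[[s], [s'], [s', s'], [t, r]], [[r, t], [r', t], [t', r'], [t', r]],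
    [[r, t, s], [r', t, s], [t, s, r], [s', t', r]],
    [[s, r, t], [t, t, s], [t', t', s], [s', t, t]]]"

definition D_words :: "bo_gen word list list" where
  "D_words = [[[t], [t, t], [t'], [t', t'], [r, s], [s', r']],
    [[s, r], [t', s], [s, t', r'], [s, t', r], [s', t], [r', s']],
    [[t, t, r], [s', t, t, s], [s, r, t, s], [s, t'], [t, s'], [s, r, s]]]"

end

definition word_classes :: "bo_gen word list \<Rightarrow> bo_gen word set set" where
  "word_classes ws = word_class BO_rels ` set ws"

text \<open>Products become concatenations, inverses of generators become formal inverse letters,
  and powers are written out.\<close>

lemma BO_sets_word_classes:
  "BO_B1 = word_classes Z_words"
  "[BO_B2, BO_B3, BO_B4, BO_B5, BO_B6, BO_B7] = map word_classes B_words"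
  "[BO_C1, BO_C2, BO_C3, BO_C4] = map word_classes C_words"
  "[BO_D1, BO_D2, BO_D3] = map word_classes D_words"
proof -
  interpret group BO48 by (rule group_BO48)
  have closed: "word_class BO_rels w \<in> carrier BO48" for w
    by (simp add: BO48_def carrier_presented_group)
  have mult: "word_class BO_rels u \<star> word_class BO_rels v = word_class BO_rels (u @ v)" for u v
    by (simp add: BO48_def mult_presented_group)
  have one: "\<one>\<^bsub>BO48\<^esub> = word_class BO_rels []"
    by (simp add: BO48_def one_presented_group)
  have inv: "(word_class BO_rels [(g, False)])\<^sup>-\<^sup>1 = word_class BO_rels [(g, True)]" for g
    by (rule inv_equality)
      (use word_cong.cancel[of g True BO_rels] in \<open>simp_all add: closed mult one word_class_eq_iff\<close>)
  have pow: "x \<up> 2 = x \<star> x" "x \<up> (- 2) = x\<^sup>-\<^sup>1 \<star> x\<^sup>-\<^sup>1" if "x \<in> carrier BO48" for x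
    using that int_pow_int[of BO48 x 2] int_pow_neg_int[of x 2]
    by (simp_all add: numeral_eq_Suc inv_mult_group)
  note simps = word_classes_def closed mult one inv pow bo_r_def bo_s_def bo_t_def generator_def
  show "BO_B1 = word_classes Z_words"
    by (simp add: BO_B1_def Z_words_def simps)
  show "[BO_B2, BO_B3, BO_B4, BO_B5, BO_B6, BO_B7] = map word_classes B_words"
    by (simp add: BO_B2_def BO_B3_def BO_B4_def BO_B5_def BO_B6_def BO_B7_def B_words_def simps)
  show "[BO_C1, BO_C2, BO_C3, BO_C4] = map word_classes C_words"
    by (simp add: BO_C1_def BO_C2_def BO_C3_def BO_C4_def C_words_def simps)
  show "[BO_D1, BO_D2, BO_D3] = map word_classes D_words"
    by (simp add: BO_D1_def BO_D2_def BO_D3_def D_words_def simps)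
qed

section \<open>The table of matrices and the finite checks on it\<close>

abbreviation noncentral_words :: "bo_gen word list list" where
  "noncentral_words \<equiv> B_words @ C_words @ D_words"

text \<open>The words are evaluated once here; the four checks that follow then run on literal
  matrices.\<close>

lemma word_matrices:
  "map word_matrix Z_words = [(1, 0, 0, 1), (6, 0, 0, 6)]"
  "map (map word_matrix) B_words =
     [[(0, 3, 2, 0), (0, 4, 5, 0)],
      [(1, 5, 1, 6), (6, 2, 6, 1)],
      [(2, 1, 2, 5), (5, 6, 5, 2)],
      [(5, 3, 3, 2), (2, 4, 4, 5)],
      [(6, 5, 1, 1), (1, 2, 6, 6)],
      [(4, 1, 4, 3), (3, 6, 3, 4)]]"
  "map (map word_matrix) C_words =
     [[(3, 0, 1, 5), (5, 0, 6, 3), (4, 0, 6, 2), (2, 0, 1, 4)],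
      [(4, 5, 0, 2), (3, 2, 0, 5), (2, 2, 0, 4), (5, 5, 0, 3)],
      [(3, 4, 2, 3), (4, 3, 5, 4), (3, 3, 5, 3), (4, 4, 2, 4)],
      [(5, 1, 4, 1), (1, 6, 3, 5), (6, 1, 4, 2), (2, 6, 3, 6)]]"
  "map (map word_matrix) D_words =
     [[(0, 1, 6, 4), (6, 4, 3, 1), (4, 6, 1, 0), (1, 3, 4, 6), (3, 1, 6, 0), (0, 6, 1, 3)],
      [(0, 2, 3, 3), (4, 2, 3, 0), (6, 6, 2, 1), (1, 1, 5, 6), (0, 5, 4, 4), (3, 5, 4, 0)],
      [(1, 4, 2, 2), (5, 2, 1, 2), (2, 5, 6, 5), (5, 4, 2, 6), (6, 3, 5, 5), (2, 3, 5, 1)]]"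
  by code_simp+


text \<open>This gives at the same time the lower bound 48 on the order, the disjointness of the
  listed sets and their cardinalities.\<close>

lemma distinct_word_matrices:
  "distinct (map word_matrix (concat (Z_words # noncentral_words)))"
  unfolding concat.simps concat_append map_append map_concat word_matrices by code_simp

lemma central_word_matrices:
  "list_all (\<lambda>x. list_all (\<lambda>y. mat2_mult x y = mat2_mult y x)
    (map word_matrix (concat (Z_words # noncentral_words)))) (map word_matrix Z_words)"
  unfolding concat.simps concat_append map_append map_concat word_matrices by code_simp

lemma commuting_word_matrices:
  "list_all (\<lambda>W. list_all (\<lambda>x. list_all (\<lambda>y. mat2_mult x y = mat2_mult y x) W) W)
    (map (map word_matrix) noncentral_words)"
  unfolding map_append word_matrices by code_simp

text \<open>\<open>sorted_wrt\<close> compares each block with every later one, so each pair of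
  different blocks is tested once.\<close>

lemma noncommuting_word_matrices:
  "sorted_wrt (\<lambda>V W. list_all (\<lambda>x. list_all (\<lambda>y. mat2_mult x y \<noteq> mat2_mult y x) W) V)
    (map (map word_matrix) noncentral_words)"
  unfolding map_append word_matrices by code_simp

text \<open>The listed words have 48 distinct matrices, hence 48 distinct classes, and the order is
  at most 48. So the list exhausts the group and the matrix representation is faithful.\<close>

lemma carrier_BO48: "carrier BO48 = word_classes (concat (Z_words # noncentral_words))"
  and word_class_eq_iff_word_matrix:
    "word_class BO_rels u = word_class BO_rels v \<longleftrightarrow> word_matrix u = word_matrix v"
proof -
  interpret octahedral_pair BO48 bo_s bo_t by (rule octahedral_pair_BO48)
  let ?W = "concat (Z_words # noncentral_words)"
  have inj: "inj_on word_matrix (set ?W)"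
    using distinct_word_matrices unfolding distinct_map by (rule conjunct2)
  have "inj_on (word_class BO_rels) (set ?W)"
    by (rule inj_onI) (rule inj_onD[OF inj word_matrix_cong])
  moreover have "distinct ?W"
    using distinct_word_matrices unfolding distinct_map by (rule conjunct1)
  moreover have "length ?W = 48"
    by (simp add: Z_words_def B_words_def C_words_def D_words_def)
  ultimately have "card (word_classes ?W) = 48"
    unfolding word_classes_def by (simp only: card_image distinct_card)
  then have card: "card (carrier BO48) \<le> card (word_classes ?W)"
    using card_carrier_le by (simp only:)
  have sub: "word_classes ?W \<subseteq> carrier BO48"
    unfolding word_classes_def BO48_def carrier_presented_group by (rule image_mono) (rule subset_UNIV)
  show carrier: "carrier BO48 = word_classes ?W"
    by (rule card_seteq[OF finite_carrier sub card, symmetric])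
  \<comment> \<open>Any word is congruent to a listed one, so injectivity on the list extends to all
    words.\<close>
  have rep: "\<exists>w'\<in>set ?W. word_class BO_rels w = word_class BO_rels w'" for w
  proof -
    have "word_class BO_rels w \<in> word_classes ?W"
      unfolding carrier[symmetric] by (simp add: BO48_def carrier_presented_group)
    then show ?thesis
      unfolding word_classes_def by blast
  qed
  show "word_class BO_rels u = word_class BO_rels v \<longleftrightarrow> word_matrix u = word_matrix v"
  proof
    assume eq: "word_matrix u = word_matrix v"
    obtain u' v' where u': "u' \<in> set ?W" "word_class BO_rels u = word_class BO_rels u'"
      and v': "v' \<in> set ?W" "word_class BO_rels v = word_class BO_rels v'"
      using rep by blast
    then have "word_matrix u' = word_matrix v'"
      using eq word_matrix_cong[OF u'(2)] word_matrix_cong[OF v'(2)] by (simp only:)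
    then have "u' = v'"
      using u'(1) v'(1) by (rule inj_onD[OF inj])
    then show "word_class BO_rels u = word_class BO_rels v"
      using u'(2) v'(2) by (simp only:)
  qed (rule word_matrix_cong)
qed

text \<open>Faithfulness transfers commutation in both directions, which is what proves the absence
  as well as the presence of edges.\<close>

lemma commute_iff_word_matrix:
  "word_class BO_rels u \<star> word_class BO_rels v = word_class BO_rels v \<star> word_class BO_rels u \<longleftrightarrow>
    mat2_mult (word_matrix u) (word_matrix v) = mat2_mult (word_matrix v) (word_matrix u)"
  by (simp add: BO48_def mult_presented_group word_class_eq_iff_word_matrix word_matrix_append)

lemma commuting_graph_block:
  assumes "W \<in> set (Z_words # noncentral_words)" "length W = m"
  shows "commuting_graph BO48 (word_classes W) \<simeq>\<^sub>g complete_graph m"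
proof (rule commuting_graph_complete)
  show "finite (word_classes W)"
    by (simp add: word_classes_def)
  have "list_all (\<lambda>x. list_all (\<lambda>y. mat2_mult x y = mat2_mult y x) (map word_matrix W)) (map word_matrix W)"
  proof (cases "W \<in> set noncentral_words")
    case True
    then have "map word_matrix W \<in> set (map (map word_matrix) noncentral_words)"
      unfolding set_map by (rule imageI)
    then show ?thesis
      by (rule commuting_word_matrices[unfolded list_all_iff[of _ "map (map _) _"], THEN bspec])
  next
    case False
    with assms(1) have "W = Z_words" by simp
    then show ?thesis
      using central_word_matrices by (auto simp: list_all_iff)
  qed
  then show "commute_sets BO48 (word_classes W) (word_classes W)"
    by (simp add: commute_sets_def word_classes_def commute_iff_word_matrix list_all_iff)
  \<comment> \<open>A block is a segment of the whole list and inherits distinctness from it; hence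
    its words represent \<open>m\<close> different elements.\<close>
  have "distinct (map word_matrix W)"
  proof -
    obtain Us Vs where "Z_words # noncentral_words = Us @ W # Vs"
      using split_list[OF assms(1)] by blast
    then have "distinct (map word_matrix (concat (Us @ W # Vs)))"
      using distinct_word_matrices by (simp only:)
    then show ?thesis
      by simp
  qed
  then have "distinct W" "inj_on word_matrix (set W)"
    unfolding distinct_map by blast+
  then have "card (word_classes W) = card (set W)"
    unfolding word_classes_def
    unfolding inj_on_def word_class_eq_iff_word_matrix[symmetric] by (intro card_image inj_onI) blast
  then show "card (word_classes W) = m"
    using \<open>distinct W\<close> assms(2) by (simp add: distinct_card)
qed

lemma nowhere_commute_word_classes:
  assumes "list_all (\<lambda>x. list_all (\<lambda>y. mat2_mult x y \<noteq> mat2_mult y x) (map word_matrix W))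
    (map word_matrix V)"
  shows "nowhere_commute BO48 (word_classes V) (word_classes W)"
  using assms by (simp add: nowhere_commute_def word_classes_def commute_iff_word_matrix list_all_iff)

lemma nowhere_commute_blocks:
  assumes "i < j" "j < length noncentral_words"
  shows "nowhere_commute BO48 (word_classes (noncentral_words ! i)) (word_classes (noncentral_words ! j))"
proof -
  have "j < length (map (map word_matrix) noncentral_words)"
    unfolding length_map by (rule assms(2))
  from sorted_wrt_nth_less[OF noncommuting_word_matrices assms(1) this]
  show ?thesis
    unfolding nth_map[OF assms(2)] nth_map[OF less_trans[OF assms]]
    by (rule nowhere_commute_word_classes)
qed

section \<open>Assembling the graph on the whole group\<close>

lemma word_classes_concat: "word_classes (concat Ws) = (\<Union>i<length Ws. word_classes (Ws ! i))"
proof -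
  have "set Ws = (!) Ws ` {..<length Ws}"
    by (auto simp: set_conv_nth)
  then show ?thesis
    by (simp add: word_classes_def image_UN)
qed

lemma length_words: "length B_words = 6" "length C_words = 4" "length D_words = 3"
  and length_block: "W \<in> set B_words \<Longrightarrow> length W = 2" "W \<in> set C_words \<Longrightarrow> length W = 4"
    "W \<in> set D_words \<Longrightarrow> length W = 6"
  by (auto simp: B_words_def C_words_def D_words_def)

lemma commuting_graph_BO48:
  "commuting_graph BO48 (carrier BO48) \<simeq>\<^sub>g graph_join (complete_graph 2)
    (disjoint_union
      (disjoint_union (graph_copies 6 (complete_graph 2)) (graph_copies 4 (complete_graph 4)))
      (graph_copies 3 (complete_graph 6)))"
proof -
  \<comment> \<open>In \<open>noncentral_words\<close> the blocks of \<open>B_words\<close> occupy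
    positions 0 to 5, those of \<open>C_words\<close> 6 to 9 and those of \<open>D_words\<close> 10
    to 12; this explains the offsets 6 and 10 below.\<close>
  have sepB: "nowhere_commute BO48 (word_classes (B_words ! i)) (word_classes (B_words ! j))"
    if "i < j" "j < 6" for i j
    using nowhere_commute_blocks[of i j] that by (simp add: nth_append length_words)
  have sepC: "nowhere_commute BO48 (word_classes (C_words ! i)) (word_classes (C_words ! j))"
    if "i < j" "j < 4" for i j
    using nowhere_commute_blocks[of "6 + i" "6 + j"] that by (simp add: nth_append length_words)
  have sepD: "nowhere_commute BO48 (word_classes (D_words ! i)) (word_classes (D_words ! j))"
    if "i < j" "j < 3" for i j
    using nowhere_commute_blocks[of "10 + i" "10 + j"] that by (simp add: nth_append length_words)
  have sepBC: "nowhere_commute BO48 (word_classes (B_words ! i)) (word_classes (C_words ! j))"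
    if "i < 6" "j < 4" for i j
    using nowhere_commute_blocks[of i "6 + j"] that by (simp add: nth_append length_words)
  have sepBD: "nowhere_commute BO48 (word_classes (B_words ! i)) (word_classes (D_words ! j))"
    if "i < 6" "j < 3" for i j
    using nowhere_commute_blocks[of i "10 + j"] that by (simp add: nth_append length_words)
  have sepCD: "nowhere_commute BO48 (word_classes (C_words ! i)) (word_classes (D_words ! j))"
    if "i < 4" "j < 3" for i j
    using nowhere_commute_blocks[of "6 + i" "10 + j"] that by (simp add: nth_append length_words)
  let ?B = "\<Union>i<6. word_classes (B_words ! i)"
  let ?C = "\<Union>i<4. word_classes (C_words ! i)"
  let ?D = "\<Union>i<3. word_classes (D_words ! i)"
  have noncentral: "word_classes (concat noncentral_words) = ?B \<union> ?C \<union> ?D"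
    using word_classes_concat[of B_words] word_classes_concat[of C_words]
      word_classes_concat[of D_words] unfolding length_words
    by (simp add: word_classes_def image_Un Un_assoc)
  have K: "parcs (complete_graph m) \<subseteq> pverts (complete_graph m) \<times> pverts (complete_graph m)" for m
    by (auto simp: complete_graph_def)
  have copies: "parcs (graph_copies k (complete_graph m))
      \<subseteq> pverts (graph_copies k (complete_graph m)) \<times> pverts (graph_copies k (complete_graph m))" for k m
    by (auto simp: complete_graph_def graph_copies_def)
  have B: "commuting_graph BO48 ?B \<simeq>\<^sub>g graph_copies 6 (complete_graph 2)"
    by (intro commuting_graph_copies K sepB commuting_graph_block)
      (simp_all add: length_words length_block)
  have C: "commuting_graph BO48 ?C \<simeq>\<^sub>g graph_copies 4 (complete_graph 4)"
    by (intro commuting_graph_copies K sepC commuting_graph_block)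
      (simp_all add: length_words length_block)
  have D: "commuting_graph BO48 ?D \<simeq>\<^sub>g graph_copies 3 (complete_graph 6)"
    by (intro commuting_graph_copies K sepD commuting_graph_block)
      (simp_all add: length_words length_block)
  have BC: "commuting_graph BO48 (?B \<union> ?C)
      \<simeq>\<^sub>g disjoint_union (graph_copies 6 (complete_graph 2)) (graph_copies 4 (complete_graph 4))"
    using sepBC by (intro commuting_graph_disjoint_union copies B C) (auto simp: nowhere_commute_def)
  have BCD: "commuting_graph BO48 (?B \<union> ?C \<union> ?D)
      \<simeq>\<^sub>g disjoint_union (disjoint_union (graph_copies 6 (complete_graph 2)) (graph_copies 4 (complete_graph 4)))
        (graph_copies 3 (complete_graph 6))"
    using sepBD sepCD by (intro commuting_graph_disjoint_union copies BC D)
      (auto simp: nowhere_commute_def disjoint_union_def graph_copies_def complete_graph_def)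
  have Z: "commuting_graph BO48 (word_classes Z_words) \<simeq>\<^sub>g complete_graph 2"
    by (rule commuting_graph_block) (simp_all add: Z_words_def)
  have "commute_sets BO48 (word_classes Z_words) (word_classes (concat noncentral_words))"
    unfolding commute_sets_def word_classes_def
  proof (intro ballI, elim imageE, hypsubst)
    fix u v assume "u \<in> set Z_words" "v \<in> set (concat noncentral_words)"
    then show "word_class BO_rels u \<star> word_class BO_rels v = word_class BO_rels v \<star> word_class BO_rels u"
      using central_word_matrices unfolding commute_iff_word_matrix list_all_iff concat.simps
      by (simp only: set_map set_append map_append) blast
  qed
  then have "commute_sets BO48 (word_classes Z_words) (?B \<union> ?C \<union> ?D)"
    unfolding noncentral .
  \<comment> \<open>Commuting sets could meet, so disjointness is read off from the distinct
    matrices.\<close>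
  moreover have "word_classes Z_words \<inter> word_classes (concat noncentral_words) = {}"
  proof -
    have "set (map word_matrix Z_words) \<inter> set (map word_matrix (concat noncentral_words)) = {}"
      using distinct_word_matrices by (simp only: concat.simps map_append distinct_append)
    then have "word_matrix u \<noteq> word_matrix v"
      if "u \<in> set Z_words" "v \<in> set (concat noncentral_words)" for u v
      using that unfolding set_map by blast
    then show ?thesis
      unfolding word_classes_def using word_matrix_cong by (blast elim!: imageE)
  qed
  then have "word_classes Z_words \<inter> (?B \<union> ?C \<union> ?D) = {}"
    unfolding noncentral .
  moreover have "carrier BO48 = word_classes Z_words \<union> word_classes (concat noncentral_words)"
    unfolding carrier_BO48 word_classes_def concat.simps set_append image_Un ..
  then have "carrier BO48 = word_classes Z_words \<union> (?B \<union> ?C \<union> ?D)"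
    unfolding noncentral .
  moreover have "parcs X \<subseteq> pverts X \<times> pverts X"
    if "X = disjoint_union
      (disjoint_union (graph_copies 6 (complete_graph 2)) (graph_copies 4 (complete_graph 4)))
      (graph_copies 3 (complete_graph 6))" for X
    unfolding that by (auto simp: disjoint_union_def graph_copies_def complete_graph_def)
  ultimately show ?thesis
    using commuting_graph_join[OF K _ Z BCD] by simp
qed

theorem proposition4p3:
  fixes \<Gamma> :: "bo_gen word set set" and G :: "bo_gen word set pair_pre_digraph"
  assumes "G = commuting_graph BO48 \<Gamma>"
  shows "(\<Gamma> \<in> {BO_B1, BO_B2, BO_B3, BO_B4, BO_B5, BO_B6, BO_B7} \<longrightarrow> G \<simeq>\<^sub>g complete_graph 2)
    \<and> (\<Gamma> \<in> {BO_C1, BO_C2, BO_C3, BO_C4} \<longrightarrow> G \<simeq>\<^sub>g complete_graph 4)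
    \<and> (\<Gamma> \<in> {BO_D1, BO_D2, BO_D3} \<longrightarrow> G \<simeq>\<^sub>g complete_graph 6)
    \<and> (\<Gamma> = carrier BO48 \<longrightarrow>
        G \<simeq>\<^sub>g graph_join (complete_graph 2)
               (disjoint_union
                 (disjoint_union (graph_copies 6 (complete_graph 2)) (graph_copies 4 (complete_graph 4)))
                 (graph_copies 3 (complete_graph 6))))"
proof (intro conjI impI)
  \<comment> \<open>The centre belongs to the first case too, since it also has two commuting
    elements; hence \<open>Z_words\<close> is put in front of \<open>B_words\<close>.\<close>
  have sets: "{BO_B1, BO_B2, BO_B3, BO_B4, BO_B5, BO_B6, BO_B7} =
      word_classes ` set (Z_words # B_words)"
    "{BO_C1, BO_C2, BO_C3, BO_C4} = word_classes ` set C_words"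
    "{BO_D1, BO_D2, BO_D3} = word_classes ` set D_words"
    using BO_sets_word_classes(1) BO_sets_word_classes(2-4)[THEN arg_cong[of _ _ set]] by simp_all
  have "length Z_words = 2"
    by (simp add: Z_words_def)
  then show "\<Gamma> \<in> {BO_B1, BO_B2, BO_B3, BO_B4, BO_B5, BO_B6, BO_B7} \<Longrightarrow> G \<simeq>\<^sub>g complete_graph 2"
    unfolding sets assms by (auto intro!: commuting_graph_block simp: length_block)
  show "\<Gamma> \<in> {BO_C1, BO_C2, BO_C3, BO_C4} \<Longrightarrow> G \<simeq>\<^sub>g complete_graph 4"
    and "\<Gamma> \<in> {BO_D1, BO_D2, BO_D3} \<Longrightarrow> G \<simeq>\<^sub>g complete_graph 6"
    unfolding sets assms by (auto intro!: commuting_graph_block simp: length_block)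
qed (simp add: assms commuting_graph_BO48)

end
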